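(* Let $N=3$ (so that $2^*=6$) and $\mu_1,\mu_2,\beta>0$. Then the system $$-\Delta u=\mu_1u^{5}+\beta u^{2}v^{3},\qquad -\Delta v=\mu_2v^{5}+\beta v^{2}u^{3}\qquad\text{in }B_2\setminus\{0\},\qquad u,v>0,\quad u,v\in C^2(B_2\setminus\{0\}),$$ admits a positive radially symmetric semi-singular solution $(u,v)$ satisfying, for some constant $A$, $$\lim_{|x|\to0}u(x)=A>0,\qquad \lim_{|x|\to0}|x|^{1/2}v(x)=(4\mu_2)^{-1/4}.$$ Moreover, its Pohozaev invariant is $D(u,v)=-\frac{\pi}{6\sqrt{\mu_2}}<0$. Similarly, there also exists a positive radial semi-singular solution $(u,v)$ of the same system satisfying, for some constant $B$, $$\lim_{|x|\to0}v(x)=B>0,\qquad \lim_{|x|\to0}|x|^{1/2}u(x)=(4\mu_1)^{-1/4}.$$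
   Context: $B_r:=\{x\in\mathbb R^3:|x|<r\}$. A solution $(u,v)$ is called semi-singular if one of $u,v$ is bounded near $x=0$ and the other is unbounded near $x=0$. For $0<r<2$ put $$D(r;u,v):=\int_{\partial B_r}\Big[\tfrac{1}{2}\Big(u\tfrac{\partial u}{\partial\nu}+v\tfrac{\partial v}{\partial\nu}\Big)-\tfrac r2(|\nabla u|^2+|\nabla v|^2)+r\Big|\tfrac{\partial u}{\partial\nu}\Big|^2+r\Big|\tfrac{\partial v}{\partial\nu}\Big|^2+\tfrac r{6}\big(\mu_1u^{6}+\mu_2v^{6}+2\beta u^{3}v^{3}\big)\Big]d\sigma,$$ with $\nu$ the unit outer normal of $\partial B_r$. By the Pohozaev identity $D(r;u,v)$ does not depend on $r$ for a solution $(u,v)$; its constant value is the Pohozaev invariant $D(u,v)$. *)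

theory Defs
  imports "HOL-Analysis.Analysis"
begin

definition partial :: "3 \<Rightarrow> (real^3 \<Rightarrow> real) \<Rightarrow> real^3 \<Rightarrow> real" where
  "partial i f x = frechet_derivative f (at x) (axis i 1)"

definition grad :: "(real^3 \<Rightarrow> real) \<Rightarrow> real^3 \<Rightarrow> real^3" where
  "grad f x = (\<chi> i. partial i f x)"

definition laplacian :: "(real^3 \<Rightarrow> real) \<Rightarrow> real^3 \<Rightarrow> real" where
  "laplacian f x = (\<Sum>i\<in>UNIV. partial i (partial i f) x)"

(* The next two notions are meant for open S: partial uses derivatives at x,
   not derivatives within S. *)
definition C1_on :: "(real^3) set \<Rightarrow> (real^3 \<Rightarrow> real) \<Rightarrow> bool" where
  "C1_on S f \<longleftrightarrow> f differentiable_on S \<and> (\<forall>i. continuous_on S (partial i f))"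

definition C2_on :: "(real^3) set \<Rightarrow> (real^3 \<Rightarrow> real) \<Rightarrow> bool" where
  "C2_on S f \<longleftrightarrow> C1_on S f \<and> (\<forall>i. C1_on S (partial i f))"

definition punctured_ball :: "(real^3) set" where
  "punctured_ball = ball 0 2 - {0}"

(* Functions are total on the whole space, but only their values on the punctured ball
   are constrained. *)
definition positive_solution ::
    "real \<Rightarrow> real \<Rightarrow> real \<Rightarrow> (real^3 \<Rightarrow> real) \<Rightarrow> (real^3 \<Rightarrow> real) \<Rightarrow> bool" where
  "positive_solution \<mu>\<^sub>1 \<mu>\<^sub>2 \<beta> u v \<longleftrightarrow>
     C2_on punctured_ball u \<and> C2_on punctured_ball v \<and>
     (\<forall>x\<in>punctured_ball.
        u x > 0 \<and> v x > 0 \<and>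
        - laplacian u x = \<mu>\<^sub>1 * u x ^ 5 + \<beta> * u x ^ 2 * v x ^ 3 \<and>
        - laplacian v x = \<mu>\<^sub>2 * v x ^ 5 + \<beta> * v x ^ 2 * u x ^ 3)"

definition radially_symmetric :: "(real^3 \<Rightarrow> real) \<Rightarrow> bool" where
  "radially_symmetric f \<longleftrightarrow>
     (\<forall>x\<in>punctured_ball. \<forall>y\<in>punctured_ball. norm x = norm y \<longrightarrow> f x = f y)"

(* Bfun f (at 0) bounds f on some punctured neighbourhood of 0. *)
definition semi_singular :: "(real^3 \<Rightarrow> real) \<Rightarrow> (real^3 \<Rightarrow> real) \<Rightarrow> bool" where
  "semi_singular u v \<longleftrightarrow>
     (Bfun u (at 0) \<and> \<not> Bfun v (at 0)) \<or> (Bfun v (at 0) \<and> \<not> Bfun u (at 0))"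

definition spherical :: "real \<Rightarrow> real \<Rightarrow> real \<Rightarrow> real^3" where
  "spherical r \<theta> \<phi> = vector [r * sin \<theta> * cos \<phi>, r * sin \<theta> * sin \<phi>, r * cos \<theta>]"

(* Surface integral over the sphere of radius r about 0: pulled back along the spherical
   parametrization, the surface element is r^2 sin(theta) dtheta dphi. *)
definition sphere_integral :: "real \<Rightarrow> (real^3 \<Rightarrow> real) \<Rightarrow> real" where
  "sphere_integral r f =
     (LINT (\<theta>, \<phi>) : {0..pi} \<times> {0..2 * pi} | lborel. f (spherical r \<theta> \<phi>) * (r\<^sup>2 * sin \<theta>))"

(* Derivative in the direction of the outer unit normal x / |x| of the sphere through x. *)
definition normal_deriv :: "(real^3 \<Rightarrow> real) \<Rightarrow> real^3 \<Rightarrow> real" where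
  "normal_deriv f x = grad f x \<bullet> (x /\<^sub>R norm x)"

definition pohozaev ::
    "real \<Rightarrow> real \<Rightarrow> real \<Rightarrow> real \<Rightarrow> (real^3 \<Rightarrow> real) \<Rightarrow> (real^3 \<Rightarrow> real) \<Rightarrow> real" where
  "pohozaev \<mu>\<^sub>1 \<mu>\<^sub>2 \<beta> r u v = sphere_integral r (\<lambda>x.
       1/2 * (u x * normal_deriv u x + v x * normal_deriv v x)
     - r/2 * ((norm (grad u x))\<^sup>2 + (norm (grad v x))\<^sup>2)
     + r * \<bar>normal_deriv u x\<bar>\<^sup>2 + r * \<bar>normal_deriv v x\<bar>\<^sup>2
     + r/6 * (\<mu>\<^sub>1 * u x ^ 6 + \<mu>\<^sub>2 * v x ^ 6 + 2 * \<beta> * u x ^ 3 * v x ^ 3))"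

(* D(u,v) = c: the quantity D(r;u,v) has the constant value c on 0 < r < 2. *)
definition has_pohozaev_invariant ::
    "real \<Rightarrow> real \<Rightarrow> real \<Rightarrow> (real^3 \<Rightarrow> real) \<Rightarrow> (real^3 \<Rightarrow> real) \<Rightarrow> real \<Rightarrow> bool" where
  "has_pohozaev_invariant \<mu>\<^sub>1 \<mu>\<^sub>2 \<beta> u v c \<longleftrightarrow>
     (\<forall>r. 0 < r \<and> r < 2 \<longrightarrow> pohozaev \<mu>\<^sub>1 \<mu>\<^sub>2 \<beta> r u v = c)"

end

theory Submission
  imports Defs
begin

text \<open>
  With $t = \ln |x|$, $u = |x|^{-1/2} z(t)$ and $v = |x|^{-1/2} w(t)$, the system for radial functions
  becomes the autonomous system
    $$w'' = w/4 - \mu_2 w^5 - \beta w^2 z^3, \qquad z'' = z/4 - \mu_1 z^5 - \beta z^2 w^3,$$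
  for which $(w, z) = (w_0, 0)$ with $w_0 = (4\mu_2)^{-1/4}$ is an equilibrium. A semi-singular solution
  is an orbit leaving this equilibrium as $t \to -\infty$ along the unstable direction
  $z \sim A e^{t/2}$. At the equilibrium the linearized equation for $w$ is $\varphi'' + \varphi = 0$.
  It has no nonzero solution that decays as $t \to -\infty$, so the only decaying $w - w_0$ is
  the one forced by the nonlinear terms.

  In the variable $\rho = e^{t/2} = |x|^{1/2}$ put $w = w_0 + \varepsilon\rho\psi$ and
  $z = \varepsilon\rho U$. Variation of constants from $t = -\infty$ turns the system into
  a Volterra equation for $(\psi, U)$ on $0 \le \rho \le 2$,
    $$\psi = -\varepsilon\, L_1[G(\varepsilon\rho, \psi, U)], \qquad
      U = 1 - \varepsilon\, L_2[H(\varepsilon\rho, \psi, U)],$$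
  with polynomials $G$, $H$ and bounded linear integral operators $L_1$, $L_2$ (\<open>osc\<close> and
  \<open>pot\<close> below). For small $\varepsilon$ the right-hand side is a contraction near the constant
  $(0, 1)$ (lemma \<open>volterra_fixed_point\<close>). Only the value $A = \varepsilon$ at the origin
  is small, not the interval, so the orbit already covers the ball of radius $2$ and no rescaling of
  the solution is needed; positivity follows from
  $|\psi|, |U - 1| \le 1/2$ and the smallness of $\varepsilon$ (lemma \<open>emden_fowler_orbit\<close>).

  In these variables $D(r; u, v)$ is $4\pi$ times the Hamiltonian of the autonomous system, which is
  constant and hence equal to its value $\mu_2 w_0^6/6 - w_0^2/8 = -1/(24\sqrt{\mu_2})$ at the
  equilibrium (lemma \<open>hamiltonian_constant\<close>). The second solution arises by exchanging the
  roles of the two components.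
\<close>

section \<open>The two integral operators\<close>

text \<open>
  The operator $\rho^{-1} \int_{-\infty}^t \sin(t - s)\, e^s g(e^{s/2})\, ds$ at $\rho = e^{t/2}$,
  written with $\sigma = e^{s/2}$ and with the addition theorem for the sine. If $\psi$ is the
  result, then $\varphi = \rho\psi$ is the decaying solution of $\varphi'' + \varphi = e^t g(e^{t/2})$.
  Division by zero gives the value $0$ at $\rho = 0$, which is also the limit; likewise for
  \<open>pot\<close>.
\<close>

definition osc :: "(real \<Rightarrow> real) \<Rightarrow> real \<Rightarrow> real" where
  "osc g \<rho> = 2 / \<rho> * (sin (2 * ln \<rho>) * integral {0..\<rho>} (\<lambda>\<sigma>. \<sigma> * cos (2 * ln \<sigma>) * g \<sigma>)
                     - cos (2 * ln \<rho>) * integral {0..\<rho>} (\<lambda>\<sigma>. \<sigma> * sin (2 * ln \<sigma>) * g \<sigma>))"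

text \<open>
  The operator $\int_{-\infty}^t (1 - e^{-(t - s)})\, e^{s/2} h(e^{s/2})\, ds$ at $\rho = e^{t/2}$, with
  $\sigma = e^{s/2}$. The result is the solution of $U'' + U' = e^{t/2} h(e^{t/2})$ that
  decays at $-\infty$.
\<close>

definition pot :: "(real \<Rightarrow> real) \<Rightarrow> real \<Rightarrow> real" where
  "pot h \<rho> = 2 * (integral {0..\<rho>} h - integral {0..\<rho>} (\<lambda>\<sigma>. \<sigma>\<^sup>2 * h \<sigma>) / \<rho>\<^sup>2)"

lemma continuous_on_from_0:
  fixes f :: "real \<Rightarrow> real"
  assumes cont: "continuous_on {0<..R} f"
    and bound: "\<And>x. 0 \<le> x \<Longrightarrow> x \<le> R \<Longrightarrow> \<bar>f x\<bar> \<le> B * x"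
  shows "continuous_on {0..R} f"
proof (cases "R \<le> 0")
  case True
  then have "{0..R} = {} \<or> {0..R} = {0}" by auto
  then show ?thesis by auto
next
  case False
  show ?thesis
    unfolding continuous_on_eq_continuous_within
  proof
    fix x assume x: "x \<in> {0..R}"
    show "continuous (at x within {0..R}) f"
    proof (cases "x = 0")
      case True
      have f0: "f 0 = 0" using bound[of 0] False by auto
      have "((\<lambda>x. B * x) \<longlongrightarrow> B * 0) (at 0 within {0..R})" by (intro tendsto_intros)
      moreover have "\<forall>\<^sub>F x in at 0 within {0..R}. norm (f x) \<le> B * x"
        unfolding eventually_at_filter by (rule always_eventually) (use bound in auto)
      ultimately have "(f \<longlongrightarrow> 0) (at 0 within {0..R})"
        by (simp add: Lim_null_comparison)
      then show ?thesis using f0 True by (simp add: continuous_within)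
    next
      case False
      with x have "x \<in> {0<..R}" by auto
      with cont have "continuous (at x within {0<..R}) f"
        by (simp add: continuous_on_eq_continuous_within)
      moreover have "at x within {0..R} = at x within {0<..R}"
        using False x by (intro at_within_nhd[of _ "{0<..}"]) auto
      ultimately show ?thesis by (simp add: continuous_within)
    qed
  qed
qed

text \<open>
  The functions $\sin(2 \ln \sigma)$ and $\cos(2 \ln \sigma)$ oscillate at $0$; the factor $\sigma$ makes
  the integrands of \<open>osc\<close> continuous there.
\<close>

lemma continuous_on_weighted:
  fixes c g :: "real \<Rightarrow> real"
  assumes g: "continuous_on {0..R} g" and c: "continuous_on {0<..} c"
    and c1: "\<And>x. \<bar>c x\<bar> \<le> 1"
  shows "continuous_on {0..R} (\<lambda>x. x * c x * g x)"
proof -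
  have "continuous_on {0..R} (\<lambda>x. x * c x)"
  proof (rule continuous_on_from_0[where B = 1])
    show "continuous_on {0<..R} (\<lambda>x. x * c x)"
      by (intro continuous_intros continuous_on_subset[OF c]) auto
  next
    fix x :: real assume "0 \<le> x" "x \<le> R"
    then show "\<bar>x * c x\<bar> \<le> 1 * x"
      using c1[of x] by (simp add: abs_mult mult_left_le)
  qed
  from continuous_on_mult[OF this g] show ?thesis .
qed

lemma osc_integrands:
  fixes g :: "real \<Rightarrow> real"
  assumes "continuous_on {0..R} g"
  shows "continuous_on {0..R} (\<lambda>\<sigma>. \<sigma> * cos (2 * ln \<sigma>) * g \<sigma>)"
    and "continuous_on {0..R} (\<lambda>\<sigma>. \<sigma> * sin (2 * ln \<sigma>) * g \<sigma>)"
  by (rule continuous_on_weighted[OF assms]; auto intro!: continuous_intros)+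

lemma abs_integral_le:
  fixes g :: "real \<Rightarrow> real"
  assumes "continuous_on {0..\<rho>} g" "0 \<le> \<rho>" "\<And>x. x \<in> {0..\<rho>} \<Longrightarrow> \<bar>g x\<bar> \<le> B"
  shows "\<bar>integral {0..\<rho>} g\<bar> \<le> B * \<rho>"
proof -
  have "B \<ge> 0" using assms(3)[of 0] assms(2) by auto
  then show ?thesis
  using has_integral_bound_real[of B "{}" g "integral {0..\<rho>} g" 0 \<rho>] assms
    integrable_continuous_interval[OF assms(1)] by (auto simp: has_integral_integral)
qed

lemma osc_bound:
  assumes g: "continuous_on {0..\<rho>} g" and \<rho>: "0 \<le> \<rho>" and B: "\<And>x. x \<in> {0..\<rho>} \<Longrightarrow> \<bar>g x\<bar> \<le> B"
  shows "\<bar>osc g \<rho>\<bar> \<le> 4 * B * \<rho>"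
proof (cases "\<rho> = 0")
  case True then show ?thesis by (simp add: osc_def)
next
  case False
  then have pos: "\<rho> > 0" using \<rho> by simp
  have B0: "B \<ge> 0" using B[of 0] pos by auto
  have est: "\<bar>x * c * g x\<bar> \<le> \<rho> * B" if "x \<in> {0..\<rho>}" "\<bar>c\<bar> \<le> 1" for x c
  proof -
    have "\<bar>x * c * g x\<bar> = \<bar>x\<bar> * \<bar>c\<bar> * \<bar>g x\<bar>" by (simp add: abs_mult)
    also have "\<dots> \<le> \<rho> * 1 * B" using that B[OF that(1)] B0 by (intro mult_mono) auto
    finally show ?thesis by simp
  qed
  have i1: "\<bar>integral {0..\<rho>} (\<lambda>\<sigma>. \<sigma> * cos (2 * ln \<sigma>) * g \<sigma>)\<bar> \<le> \<rho> * B * \<rho>" (is "\<bar>?C\<bar> \<le> _")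
    by (rule abs_integral_le[OF osc_integrands(1)[OF g] \<rho>]) (auto intro: est)
  have i2: "\<bar>integral {0..\<rho>} (\<lambda>\<sigma>. \<sigma> * sin (2 * ln \<sigma>) * g \<sigma>)\<bar> \<le> \<rho> * B * \<rho>" (is "\<bar>?S\<bar> \<le> _")
    by (rule abs_integral_le[OF osc_integrands(2)[OF g] \<rho>]) (auto intro: est)
  have "\<bar>sin (2 * ln \<rho>) * ?C - cos (2 * ln \<rho>) * ?S\<bar> \<le> \<bar>sin (2 * ln \<rho>) * ?C\<bar> + \<bar>cos (2 * ln \<rho>) * ?S\<bar>"
    by linarith
  also have "\<dots> \<le> 1 * \<bar>?C\<bar> + 1 * \<bar>?S\<bar>"
    unfolding abs_mult by (intro add_mono mult_right_mono) auto
  also have "\<dots> \<le> 2 * \<rho> * B * \<rho>" using i1 i2 by simp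
  finally have "2 / \<rho> * \<bar>sin (2 * ln \<rho>) * ?C - cos (2 * ln \<rho>) * ?S\<bar> \<le> 2 / \<rho> * (2 * \<rho> * B * \<rho>)"
    using pos by (intro mult_left_mono) auto
  also have "\<dots> = 4 * B * \<rho>" using pos by (simp add: field_simps)
  finally show ?thesis using pos unfolding osc_def abs_mult by simp
qed

lemma pot_bound:
  assumes g: "continuous_on {0..\<rho>} g" and \<rho>: "0 \<le> \<rho>" and B: "\<And>x. x \<in> {0..\<rho>} \<Longrightarrow> \<bar>g x\<bar> \<le> B"
  shows "\<bar>pot g \<rho>\<bar> \<le> 4 * B * \<rho>"
proof (cases "\<rho> = 0")
  case True then show ?thesis by (simp add: pot_def)
next
  case False
  then have pos: "\<rho> > 0" using \<rho> by simp
  have B0: "B \<ge> 0" using B[of 0] pos by auto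
  have i1: "\<bar>integral {0..\<rho>} g\<bar> \<le> B * \<rho>"
    by (rule abs_integral_le[OF g \<rho> B])
  have i2: "\<bar>integral {0..\<rho>} (\<lambda>\<sigma>. \<sigma>\<^sup>2 * g \<sigma>)\<bar> \<le> (\<rho>\<^sup>2 * B) * \<rho>" (is "\<bar>?S\<bar> \<le> _")
  proof (rule abs_integral_le[OF _ \<rho>])
    show "continuous_on {0..\<rho>} (\<lambda>\<sigma>. \<sigma>\<^sup>2 * g \<sigma>)" by (intro continuous_intros g)
    fix x assume x: "x \<in> {0..\<rho>}"
    have "\<bar>x\<^sup>2 * g x\<bar> = x\<^sup>2 * \<bar>g x\<bar>" by (simp add: abs_mult)
    also have "\<dots> \<le> \<rho>\<^sup>2 * B" using x B[OF x] B0 by (intro mult_mono power_mono) auto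
    finally show "\<bar>x\<^sup>2 * g x\<bar> \<le> \<rho>\<^sup>2 * B" .
  qed
  have "\<bar>?S / \<rho>\<^sup>2\<bar> \<le> B * \<rho>"
    using i2 pos by (simp add: field_simps)
  then have "\<bar>integral {0..\<rho>} g - ?S / \<rho>\<^sup>2\<bar> \<le> 2 * (B * \<rho>)" using i1 by linarith
  then show ?thesis unfolding pot_def by simp
qed

lemma has_real_derivative_integral:
  fixes g :: "real \<Rightarrow> real"
  assumes "continuous_on {0..R} g" "0 < x" "x < R"
  shows "((\<lambda>x. integral {0..x} g) has_real_derivative g x) (at x)"
proof -
  have "((\<lambda>x. integral {0..x} g) has_real_derivative g x) (at x within {0..R})"
    using assms by (intro integral_has_real_derivative) auto
  then show ?thesis using assms at_within_Icc_at[of 0 x R] by simp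
qed

lemma continuous_on_osc:
  assumes g: "continuous_on {0..R} g"
  shows "continuous_on {0..R} (osc g)"
proof -
  obtain B where B: "\<And>x. x \<in> {0..R} \<Longrightarrow> \<bar>g x\<bar> \<le> B"
    using compact_imp_bounded[OF compact_continuous_image[OF g compact_Icc]]
    by (force simp: bounded_iff)
  have sub: "continuous_on {0..x} g" if "x \<le> R" for x
    using that by (intro continuous_on_subset[OF g]) auto
  show ?thesis
  proof (rule continuous_on_from_0[where B = "4 * B"])
    fix x assume "0 \<le> x" "x \<le> R"
    then show "\<bar>osc g x\<bar> \<le> 4 * B * x" using sub B by (intro osc_bound) auto
  next
    have ic: "continuous_on {0..R} (\<lambda>x. integral {0..x} f)" if "continuous_on {0..R} f" for f :: "real \<Rightarrow> real"
      by (intro indefinite_integral_continuous_1 integrable_continuous_interval that)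
    show "continuous_on {0<..R} (osc g)"
      unfolding osc_def
      by (intro continuous_intros continuous_on_subset[OF ic[OF osc_integrands(1)[OF g]]]
          continuous_on_subset[OF ic[OF osc_integrands(2)[OF g]]]) auto
  qed
qed

lemma continuous_on_pot:
  assumes g: "continuous_on {0..R} g"
  shows "continuous_on {0..R} (pot g)"
proof -
  obtain B where B: "\<And>x. x \<in> {0..R} \<Longrightarrow> \<bar>g x\<bar> \<le> B"
    using compact_imp_bounded[OF compact_continuous_image[OF g compact_Icc]]
    by (force simp: bounded_iff)
  have sub: "continuous_on {0..x} g" if "x \<le> R" for x
    using that by (intro continuous_on_subset[OF g]) auto
  show ?thesis
  proof (rule continuous_on_from_0[where B = "4 * B"])
    fix x assume "0 \<le> x" "x \<le> R"
    then show "\<bar>pot g x\<bar> \<le> 4 * B * x" using sub B by (intro pot_bound) auto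
  next
    have ic: "continuous_on {0<..R} (\<lambda>x. integral {0..x} f)" if "continuous_on {0..R} f" for f :: "real \<Rightarrow> real"
      by (rule continuous_on_subset[OF indefinite_integral_continuous_1])
        (auto intro: integrable_continuous_interval that)
    show "continuous_on {0<..R} (pot g)"
      unfolding pot_def by (intro continuous_intros ic g) auto
  qed
qed

lemma osc_diff:
  assumes "continuous_on {0..\<rho>} f" "continuous_on {0..\<rho>} g"
  shows "osc f \<rho> - osc g \<rho> = osc (\<lambda>x. f x - g x) \<rho>"
proof -
  note i = integrable_continuous_interval[OF osc_integrands(1)] integrable_continuous_interval[OF osc_integrands(2)]
  have "integral {0..\<rho>} (\<lambda>\<sigma>. \<sigma> * cos (2 * ln \<sigma>) * (f \<sigma> - g \<sigma>))
      = integral {0..\<rho>} (\<lambda>\<sigma>. \<sigma> * cos (2 * ln \<sigma>) * f \<sigma>) - integral {0..\<rho>} (\<lambda>\<sigma>. \<sigma> * cos (2 * ln \<sigma>) * g \<sigma>)"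
    by (subst integral_diff[symmetric]) (auto intro!: i assms simp: right_diff_distrib)
  moreover have "integral {0..\<rho>} (\<lambda>\<sigma>. \<sigma> * sin (2 * ln \<sigma>) * (f \<sigma> - g \<sigma>))
      = integral {0..\<rho>} (\<lambda>\<sigma>. \<sigma> * sin (2 * ln \<sigma>) * f \<sigma>) - integral {0..\<rho>} (\<lambda>\<sigma>. \<sigma> * sin (2 * ln \<sigma>) * g \<sigma>)"
    by (subst integral_diff[symmetric]) (auto intro!: i assms simp: right_diff_distrib)
  ultimately show ?thesis unfolding osc_def by (simp only:) (simp add: algebra_simps)
qed

lemma pot_diff:
  assumes "continuous_on {0..\<rho>} f" "continuous_on {0..\<rho>} g"
  shows "pot f \<rho> - pot g \<rho> = pot (\<lambda>x. f x - g x) \<rho>"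
proof -
  have "integral {0..\<rho>} (\<lambda>\<sigma>. f \<sigma> - g \<sigma>) = integral {0..\<rho>} f - integral {0..\<rho>} g"
    by (intro integral_diff integrable_continuous_interval assms)
  moreover have "integral {0..\<rho>} (\<lambda>\<sigma>. \<sigma>\<^sup>2 * (f \<sigma> - g \<sigma>))
      = integral {0..\<rho>} (\<lambda>\<sigma>. \<sigma>\<^sup>2 * f \<sigma>) - integral {0..\<rho>} (\<lambda>\<sigma>. \<sigma>\<^sup>2 * g \<sigma>)"
    by (subst integral_diff[symmetric])
      (auto intro!: integrable_continuous_interval continuous_intros assms simp: algebra_simps)
  ultimately show ?thesis unfolding pot_def by (simp only:) (simp add: algebra_simps diff_divide_distrib)
qed

text \<open>
  Existence for the Volterra equation, by Banach's theorem in the space of bounded continuous functions.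
  The factor $32$ is what the bounds $4 B \rho \le 8 B$ for the two operators require.
\<close>

lemma volterra_fixed_point:
  fixes G H :: "real \<Rightarrow> real \<times> real \<Rightarrow> real" and p0 :: "real \<times> real"
  defines "B \<equiv> cball p0 (1/2)"
  assumes contG: "\<And>P. continuous_on {0..2} P \<Longrightarrow> continuous_on {0..2} (\<lambda>\<sigma>. G \<sigma> (P \<sigma>))"
    and contH: "\<And>P. continuous_on {0..2} P \<Longrightarrow> continuous_on {0..2} (\<lambda>\<sigma>. H \<sigma> (P \<sigma>))"
    and G: "\<And>\<sigma> p. \<sigma> \<in> {0..2} \<Longrightarrow> p \<in> B \<Longrightarrow> \<bar>G \<sigma> p\<bar> \<le> K"
    and H: "\<And>\<sigma> p. \<sigma> \<in> {0..2} \<Longrightarrow> p \<in> B \<Longrightarrow> \<bar>H \<sigma> p\<bar> \<le> K"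
    and lipG: "\<And>\<sigma> p q. \<sigma> \<in> {0..2} \<Longrightarrow> p \<in> B \<Longrightarrow> q \<in> B \<Longrightarrow> \<bar>G \<sigma> p - G \<sigma> q\<bar> \<le> K * dist p q"
    and lipH: "\<And>\<sigma> p q. \<sigma> \<in> {0..2} \<Longrightarrow> p \<in> B \<Longrightarrow> q \<in> B \<Longrightarrow> \<bar>H \<sigma> p - H \<sigma> q\<bar> \<le> K * dist p q"
    and \<epsilon>: "0 \<le> \<epsilon>" "32 * \<epsilon> * K \<le> 1"
  obtains P where "continuous_on {0..2} P" "\<And>\<rho>. \<rho> \<in> {0..2} \<Longrightarrow> P \<rho> \<in> B"
    "\<And>\<rho>. \<rho> \<in> {0..2} \<Longrightarrow>
       P \<rho> = p0 - \<epsilon> *\<^sub>R (osc (\<lambda>\<sigma>. G \<sigma> (P \<sigma>)) \<rho>, pot (\<lambda>\<sigma>. H \<sigma> (P \<sigma>)) \<rho>)"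
proof -
  \<comment> \<open>Bounded continuous functions are taken on the whole real line; the image under the operator is
    extended from the interval by constants.\<close>
  define c :: "real \<Rightarrow> real" where "c x = max 0 (min 2 x)" for x
  have c: "c x \<in> {0..2}" for x by (auto simp: c_def)
  have c_id: "c x = x" if "x \<in> {0..2}" for x using that by (auto simp: c_def)
  have cont_c: "continuous_on UNIV c" unfolding c_def by (intro continuous_intros)
  define V :: "(real \<Rightarrow> real \<times> real) \<Rightarrow> real \<Rightarrow> real \<times> real" where
    "V P x = p0 - \<epsilon> *\<^sub>R (osc (\<lambda>\<sigma>. G \<sigma> (P \<sigma>)) x, pot (\<lambda>\<sigma>. H \<sigma> (P \<sigma>)) x)" for P x
  define S :: "(real \<Rightarrow>\<^sub>C (real \<times> real)) set" where "S = PiC UNIV (\<lambda>_. B)"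
  have S_iff: "P \<in> S \<longleftrightarrow> (\<forall>x. P x \<in> B)" for P :: "real \<Rightarrow>\<^sub>C (real \<times> real)"
    by (auto simp: S_def mem_PiC_iff)
  have cont_P: "continuous_on A (apply_bcontfun P)" for A and P :: "real \<Rightarrow>\<^sub>C (real \<times> real)"
    by (rule continuous_on_apply_bcontfun)
  \<comment> \<open>The common estimate behind the invariance of the ball ($d = 1$) and the contraction
    ($d$ the distance of two functions).\<close>
  have pair: "norm (\<epsilon> *\<^sub>R (a, b)) \<le> d / 2"
    if "\<bar>a\<bar> \<le> 4 * (K * d) * x" "\<bar>b\<bar> \<le> 4 * (K * d) * x" "x \<in> {0..2}" "d \<ge> 0" "K \<ge> 0" for a b d x :: real
  proof -
    have "4 * (K * d) * x \<le> 4 * (K * d) * 2" using that by (intro mult_left_mono) auto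
    then have "\<bar>a\<bar> + \<bar>b\<bar> \<le> 16 * (K * d)" using that by linarith
    moreover have "norm (a, b) \<le> \<bar>a\<bar> + \<bar>b\<bar>"
      using norm_Pair_le[of a b] by simp
    ultimately have "norm (a, b) \<le> 16 * K * d" by linarith
    then have "norm (\<epsilon> *\<^sub>R (a, b)) \<le> \<epsilon> * (16 * K * d)" using \<epsilon>
      by (simp only: norm_scaleR) (auto intro!: mult_left_mono)
    also have "\<dots> = (32 * \<epsilon> * K) * (d / 2)" by simp
    also have "\<dots> \<le> 1 * (d / 2)" using \<epsilon> that by (intro mult_right_mono) auto
    finally show ?thesis by simp
  qed
  have p0B: "p0 \<in> B" by (simp add: B_def)
  have K0: "K \<ge> 0" using G[of 0 p0] p0B by force
  have contV: "continuous_on UNIV (\<lambda>x. V P (c x))" for P :: "real \<Rightarrow>\<^sub>C (real \<times> real)"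
  proof -
    have "continuous_on {0..2} (V P)" unfolding V_def
      by (intro continuous_intros continuous_on_osc continuous_on_pot contG contH cont_P)
    then have "continuous_on (c ` UNIV) (V P)" by (rule continuous_on_subset) (use c in auto)
    from continuous_on_compose[OF cont_c this] show ?thesis by (simp add: o_def)
  qed
  have VB: "V P x \<in> B" if P: "P \<in> S" and x: "x \<in> {0..2}" for P x
  proof -
    have PB: "P y \<in> B" for y using P S_iff by auto
    have sub: "continuous_on {0..x} f" if "continuous_on {0..2} f" for f :: "real \<Rightarrow> real"
      using that by (rule continuous_on_subset) (use x in auto)
    have "norm (\<epsilon> *\<^sub>R (osc (\<lambda>\<sigma>. G \<sigma> (P \<sigma>)) x, pot (\<lambda>\<sigma>. H \<sigma> (P \<sigma>)) x)) \<le> 1/2"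
      using x G H PB K0
      by (intro pair[of _ _ x] osc_bound pot_bound sub contG contH cont_P) auto
    then show ?thesis by (simp add: B_def V_def dist_norm)
  qed
  define T :: "(real \<Rightarrow>\<^sub>C (real \<times> real)) \<Rightarrow> (real \<Rightarrow>\<^sub>C (real \<times> real))" where
    "T P = Bcontfun (\<lambda>x. V P (c x))" for P
  have T: "apply_bcontfun (T P) = (\<lambda>x. V P (c x))" if "P \<in> S" for P
  proof -
    have "range (\<lambda>x. V P (c x)) \<subseteq> B" using VB[OF that c] by (rule image_subsetI)
    then have "bounded (range (\<lambda>x. V P (c x)))"
      unfolding B_def by (rule bounded_subset[OF bounded_cball])
    then have "(\<lambda>x. V P (c x)) \<in> bcontfun"
      unfolding bcontfun_def using contV[of P] by simp
    then show ?thesis by (simp add: T_def Bcontfun_inverse)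
  qed
  have "\<exists>!P\<in>S. T P = P"
  proof (rule Banach_fix[of S "1/2"])
    have "closed S" unfolding S_def B_def by (intro closed_PiC closed_cball)
    then show "complete S" by (simp only: complete_eq_closed)
    have "const_bcontfun p0 \<in> S" using p0B by (simp add: S_iff)
    then show "S \<noteq> {}" by (metis empty_iff)
    show "T ` S \<subseteq> S"
    proof
      fix Q assume "Q \<in> T ` S"
      then obtain P where P: "P \<in> S" "Q = T P" by auto
      show "Q \<in> S" using T[OF P(1)] VB[OF P(1)] c P(2) by (simp add: S_iff)
    qed
    fix P Q assume PQ: "P \<in> S" "Q \<in> S"
    show "dist (T P) (T Q) \<le> 1/2 * dist P Q"
    proof (rule dist_bound)
      fix y
      have PB: "P x \<in> B" "Q x \<in> B" for x using PQ S_iff by auto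
      define x where "x = c y"
      have x: "x \<in> {0..2}" unfolding x_def by (rule c)
      have sub: "continuous_on {0..x} f" if "continuous_on {0..2} f" for f :: "real \<Rightarrow> real"
        using that by (rule continuous_on_subset) (use x in auto)
      have dle: "K * dist (P z) (Q z) \<le> K * dist P Q" for z
        using dist_bounded[of P z Q] K0 by (intro mult_left_mono) auto
      have lipG': "\<bar>G z (P z) - G z (Q z)\<bar> \<le> K * dist P Q" if "z \<in> {0..x}" for z
        using order_trans[OF lipG[OF _ PB] dle] that x by simp
      have ob: "\<bar>osc (\<lambda>\<sigma>. G \<sigma> (P \<sigma>)) x - osc (\<lambda>\<sigma>. G \<sigma> (Q \<sigma>)) x\<bar> \<le> 4 * (K * dist P Q) * x"
        unfolding osc_diff[OF sub[OF contG[OF cont_P]] sub[OF contG[OF cont_P]]]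
        by (intro osc_bound continuous_on_diff sub contG cont_P lipG') (use x in auto)
      have lipH': "\<bar>H z (P z) - H z (Q z)\<bar> \<le> K * dist P Q" if "z \<in> {0..x}" for z
        using order_trans[OF lipH[OF _ PB] dle] that x by simp
      have pb: "\<bar>pot (\<lambda>\<sigma>. H \<sigma> (P \<sigma>)) x - pot (\<lambda>\<sigma>. H \<sigma> (Q \<sigma>)) x\<bar> \<le> 4 * (K * dist P Q) * x"
        unfolding pot_diff[OF sub[OF contH[OF cont_P]] sub[OF contH[OF cont_P]]]
        by (intro pot_bound continuous_on_diff sub contH cont_P lipH') (use x in auto)
      have "dist (V P x) (V Q x) \<le> dist P Q / 2"
      proof -
        have "V Q x - V P x = \<epsilon> *\<^sub>R
          (osc (\<lambda>\<sigma>. G \<sigma> (P \<sigma>)) x - osc (\<lambda>\<sigma>. G \<sigma> (Q \<sigma>)) x,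
           pot (\<lambda>\<sigma>. H \<sigma> (P \<sigma>)) x - pot (\<lambda>\<sigma>. H \<sigma> (Q \<sigma>)) x)"
          by (simp add: V_def algebra_simps)
        then show ?thesis
          using pair[OF ob pb x zero_le_dist K0] by (simp only: dist_commute[of "V P x"] dist_norm[of "V Q x"])
      qed
      then show "dist (T P y) (T Q y) \<le> 1/2 * dist P Q"
        using T[OF PQ(1)] T[OF PQ(2)] by (simp add: x_def)
    qed
  qed auto
  then obtain P where P: "P \<in> S" "T P = P" by blast
  have PV: "P x = V P x" if "x \<in> {0..2}" for x
    using fun_cong[OF T[OF P(1)], of x] unfolding P(2) c_id[OF that] .
  show thesis
  proof (rule that[of "apply_bcontfun P"])
    show "continuous_on {0..2} P" by (rule cont_P)
    show "P \<rho> \<in> B" for \<rho> using P(1) S_iff by blast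
    show "P \<rho> = p0 - \<epsilon> *\<^sub>R (osc (\<lambda>\<sigma>. G \<sigma> (P \<sigma>)) \<rho>, pot (\<lambda>\<sigma>. H \<sigma> (P \<sigma>)) \<rho>)"
      if "\<rho> \<in> {0..2}" for \<rho>
      using PV[OF that] unfolding V_def .
  qed
qed

section \<open>Lipschitz bounds for polynomial nonlinearities\<close>

text \<open>
  Boundedness and Lipschitz continuity in the second argument, uniformly in the parameter
  $z \in Z$, with a single constant serving both purposes. This class of functions is closed under
  sums and products, so it contains all polynomials on bounded sets.
\<close>

definition bounded_lipschitz :: "'z set \<Rightarrow> 'a::metric_space set \<Rightarrow> ('z \<Rightarrow> 'a \<Rightarrow> real) \<Rightarrow> bool" where
  "bounded_lipschitz Z B f \<longleftrightarrow>
     (\<exists>K\<ge>0. \<forall>z\<in>Z. \<forall>p\<in>B. \<bar>f z p\<bar> \<le> K \<and> (\<forall>q\<in>B. \<bar>f z p - f z q\<bar> \<le> K * dist p q))"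

lemma bounded_lipschitzI:
  assumes "0 \<le> K" "\<And>z p. z \<in> Z \<Longrightarrow> p \<in> B \<Longrightarrow> \<bar>f z p\<bar> \<le> K"
    "\<And>z p q. z \<in> Z \<Longrightarrow> p \<in> B \<Longrightarrow> q \<in> B \<Longrightarrow> \<bar>f z p - f z q\<bar> \<le> K * dist p q"
  shows "bounded_lipschitz Z B f"
  using assms unfolding bounded_lipschitz_def by blast

lemma bounded_lipschitzE:
  assumes "bounded_lipschitz Z B f"
  obtains K where "0 \<le> K" "\<And>z p. z \<in> Z \<Longrightarrow> p \<in> B \<Longrightarrow> \<bar>f z p\<bar> \<le> K"
    "\<And>z p q. z \<in> Z \<Longrightarrow> p \<in> B \<Longrightarrow> q \<in> B \<Longrightarrow> \<bar>f z p - f z q\<bar> \<le> K * dist p q"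
  using assms unfolding bounded_lipschitz_def by blast

lemma bounded_lipschitz_param:
  fixes c :: "'z \<Rightarrow> real"
  assumes "bounded (c ` Z)"
  shows "bounded_lipschitz Z B (\<lambda>z p. c z)"
proof -
  obtain K where "K > 0" "\<And>z. z \<in> Z \<Longrightarrow> \<bar>c z\<bar> \<le> K"
    using assms unfolding bounded_pos by force
  then show ?thesis by (intro bounded_lipschitzI[of K]) auto
qed

lemma bounded_lipschitz_fst:
  fixes B :: "(real \<times> real) set"
  assumes "bounded B"
  shows "bounded_lipschitz Z B (\<lambda>z. fst)"
proof -
  obtain K where K: "K > 0" "\<And>p. p \<in> B \<Longrightarrow> norm p \<le> K"
    using assms unfolding bounded_pos by force
  show ?thesis
  proof (rule bounded_lipschitzI[of "K + 1"])
    fix p q :: "real \<times> real" assume "p \<in> B"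
    show "\<bar>fst p\<bar> \<le> K + 1" using norm_fst_le[of "fst p" "snd p"] K(2)[OF \<open>p \<in> B\<close>] by simp
    have "\<bar>fst p - fst q\<bar> \<le> 1 * dist p q" using dist_fst_le[of p q] by (simp add: dist_real_def)
    also have "\<dots> \<le> (K + 1) * dist p q" using K by (intro mult_right_mono) auto
    finally show "\<bar>fst p - fst q\<bar> \<le> (K + 1) * dist p q" .
  qed (use K in auto)
qed

lemma bounded_lipschitz_snd:
  fixes B :: "(real \<times> real) set"
  assumes "bounded B"
  shows "bounded_lipschitz Z B (\<lambda>z. snd)"
proof -
  obtain K where K: "K > 0" "\<And>p. p \<in> B \<Longrightarrow> norm p \<le> K"
    using assms unfolding bounded_pos by force
  show ?thesis
  proof (rule bounded_lipschitzI[of "K + 1"])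
    fix p q :: "real \<times> real" assume "p \<in> B"
    show "\<bar>snd p\<bar> \<le> K + 1" using norm_snd_le[of "snd p" "fst p"] K(2)[OF \<open>p \<in> B\<close>] by simp
    have "\<bar>snd p - snd q\<bar> \<le> 1 * dist p q" using dist_snd_le[of p q] by (simp add: dist_real_def)
    also have "\<dots> \<le> (K + 1) * dist p q" using K by (intro mult_right_mono) auto
    finally show "\<bar>snd p - snd q\<bar> \<le> (K + 1) * dist p q" .
  qed (use K in auto)
qed

lemma bounded_lipschitz_add:
  assumes "bounded_lipschitz Z B f" "bounded_lipschitz Z B g"
  shows "bounded_lipschitz Z B (\<lambda>z p. f z p + g z p)"
proof -
  obtain K where K: "0 \<le> K" "\<And>z p. z \<in> Z \<Longrightarrow> p \<in> B \<Longrightarrow> \<bar>f z p\<bar> \<le> K"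
    "\<And>z p q. z \<in> Z \<Longrightarrow> p \<in> B \<Longrightarrow> q \<in> B \<Longrightarrow> \<bar>f z p - f z q\<bar> \<le> K * dist p q"
    using bounded_lipschitzE[OF assms(1)] by blast
  obtain L where L: "0 \<le> L" "\<And>z p. z \<in> Z \<Longrightarrow> p \<in> B \<Longrightarrow> \<bar>g z p\<bar> \<le> L"
    "\<And>z p q. z \<in> Z \<Longrightarrow> p \<in> B \<Longrightarrow> q \<in> B \<Longrightarrow> \<bar>g z p - g z q\<bar> \<le> L * dist p q"
    using bounded_lipschitzE[OF assms(2)] by blast
  show ?thesis
  proof (rule bounded_lipschitzI[of "K + L"])
    fix z p q assume *: "z \<in> Z" "p \<in> B" "q \<in> B"
    show "\<bar>f z p + g z p - (f z q + g z q)\<bar> \<le> (K + L) * dist p q"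
      using K(3)[OF *] L(3)[OF *] by (simp add: algebra_simps)
  next
    fix z p assume *: "z \<in> Z" "p \<in> B"
    show "\<bar>f z p + g z p\<bar> \<le> K + L" using K(2)[OF *] L(2)[OF *] by linarith
  qed (use K L in auto)
qed

lemma bounded_lipschitz_mult:
  assumes "bounded_lipschitz Z B f" "bounded_lipschitz Z B g"
  shows "bounded_lipschitz Z B (\<lambda>z p. f z p * g z p)"
proof -
  obtain K where K: "0 \<le> K" "\<And>z p. z \<in> Z \<Longrightarrow> p \<in> B \<Longrightarrow> \<bar>f z p\<bar> \<le> K"
    "\<And>z p q. z \<in> Z \<Longrightarrow> p \<in> B \<Longrightarrow> q \<in> B \<Longrightarrow> \<bar>f z p - f z q\<bar> \<le> K * dist p q"
    using bounded_lipschitzE[OF assms(1)] by blast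
  obtain L where L: "0 \<le> L" "\<And>z p. z \<in> Z \<Longrightarrow> p \<in> B \<Longrightarrow> \<bar>g z p\<bar> \<le> L"
    "\<And>z p q. z \<in> Z \<Longrightarrow> p \<in> B \<Longrightarrow> q \<in> B \<Longrightarrow> \<bar>g z p - g z q\<bar> \<le> L * dist p q"
    using bounded_lipschitzE[OF assms(2)] by blast
  show ?thesis
  proof (rule bounded_lipschitzI[of "2 * K * L"])
    fix z p q assume *: "z \<in> Z" "p \<in> B" "q \<in> B"
    have "f z p * g z p - f z q * g z q = f z p * (g z p - g z q) + (f z p - f z q) * g z q"
      by (simp add: algebra_simps)
    also have "\<bar>\<dots>\<bar> \<le> \<bar>f z p\<bar> * \<bar>g z p - g z q\<bar> + \<bar>f z p - f z q\<bar> * \<bar>g z q\<bar>"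
      by (simp add: abs_mult order_trans[OF abs_triangle_ineq])
    also have "\<dots> \<le> K * (L * dist p q) + (K * dist p q) * L"
      using K L * by (intro add_mono mult_mono) auto
    also have "\<dots> = 2 * K * L * dist p q" by simp
    finally show "\<bar>f z p * g z p - f z q * g z q\<bar> \<le> 2 * K * L * dist p q" .
  next
    fix z p assume *: "z \<in> Z" "p \<in> B"
    have "\<bar>f z p * g z p\<bar> \<le> K * L"
      unfolding abs_mult using K L * by (intro mult_mono) auto
    also have "\<dots> \<le> 2 * K * L" using K L by simp
    finally show "\<bar>f z p * g z p\<bar> \<le> 2 * K * L" .
  qed (use K L in auto)
qed

lemma bounded_lipschitz_power:
  assumes "bounded_lipschitz Z B f"
  shows "bounded_lipschitz Z B (\<lambda>z p. f z p ^ n)"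
proof (induction n)
  case 0
  show ?case using bounded_lipschitz_param[of "\<lambda>_. 1" Z B] by (simp add: image_constant_conv)
next
  case (Suc n)
  show ?case using bounded_lipschitz_mult[OF assms Suc] by simp
qed

lemmas bounded_lipschitz_intros = bounded_lipschitz_fst bounded_lipschitz_snd
  bounded_lipschitz_add bounded_lipschitz_mult bounded_lipschitz_power bounded_lipschitz_param

section \<open>The orbit leaving the equilibrium\<close>

lemma tendsto_exp_half_at_bot: "filterlim (\<lambda>t::real. exp (t / 2)) (at_right 0) at_bot"
proof -
  have "filterlim (\<lambda>t::real. t / 2) at_bot at_bot"
    using filterlim_tendsto_pos_mult_at_bot[OF tendsto_const[of "1/2::real"] _ filterlim_ident] by simp
  from filterlim_compose[OF exp_at_bot this]
  have "((\<lambda>t::real. exp (t / 2)) \<longlongrightarrow> 0) at_bot" .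
  then show ?thesis by (intro tendsto_imp_filterlim_at_right) auto
qed

lemma tendsto_integral_exp_half:
  fixes f :: "real \<Rightarrow> real"
  assumes f: "continuous_on {0..R} f" and R: "0 < R"
  shows "((\<lambda>t. integral {0..exp (t / 2)} f) \<longlongrightarrow> 0) at_bot"
proof -
  have "continuous_on {0..R} (\<lambda>x. integral {0..x} f)"
    by (intro indefinite_integral_continuous_1 integrable_continuous_interval f)
  then have "((\<lambda>x. integral {0..x} f) \<longlongrightarrow> integral {0..0} f) (at 0 within {0..R})"
    unfolding continuous_on_def by (rule bspec) (use R in simp)
  then have "((\<lambda>x. integral {0..x} f) \<longlongrightarrow> 0) (at_right 0)"
    using R by (simp add: at_within_Icc_at_right)
  from filterlim_compose[OF this tendsto_exp_half_at_bot] show ?thesis .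
qed

lemma integral_exp_half_derivative:
  fixes f :: "real \<Rightarrow> real"
  assumes f: "continuous_on {0..R} f" and t: "exp (t / 2) < R"
  shows "((\<lambda>t. integral {0..exp (t / 2)} f) has_real_derivative f (exp (t / 2)) * (exp (t / 2) / 2)) (at t)"
  by (rule DERIV_chain2[where g="\<lambda>t. exp (t / 2)", OF has_real_derivative_integral[OF f _ t]]) (auto intro!: derivative_eq_intros)

text \<open>
  The bound $t < 1$ is a convenient one above $\ln 2$ for which $e^{t/2}$ stays below the endpoint $2$
  of the interval in the Volterra equation.
\<close>

lemma emden_fowler_orbit:
  fixes \<mu>\<^sub>1 \<mu>\<^sub>2 \<beta> :: real
  assumes \<mu>\<^sub>2: "\<mu>\<^sub>2 > 0"
  obtains w w' z z' :: "real \<Rightarrow> real" and A where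
    "\<And>t. t < 1 \<Longrightarrow> 0 < w t" "\<And>t. t < 1 \<Longrightarrow> 0 < z t"
    "\<And>t. t < 1 \<Longrightarrow> (w has_real_derivative w' t) (at t)"
    "\<And>t. t < 1 \<Longrightarrow> (w' has_real_derivative w t / 4 - \<mu>\<^sub>2 * w t ^ 5 - \<beta> * w t ^ 2 * z t ^ 3) (at t)"
    "\<And>t. t < 1 \<Longrightarrow> (z has_real_derivative z' t) (at t)"
    "\<And>t. t < 1 \<Longrightarrow> (z' has_real_derivative z t / 4 - \<mu>\<^sub>1 * z t ^ 5 - \<beta> * z t ^ 2 * w t ^ 3) (at t)"
    "(w \<longlongrightarrow> (4 * \<mu>\<^sub>2) powr (- (1/4))) at_bot" "(w' \<longlongrightarrow> 0) at_bot"
    "(z \<longlongrightarrow> 0) at_bot" "(z' \<longlongrightarrow> 0) at_bot"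
    "0 < A" "((\<lambda>t. exp (- (t / 2)) * z t) \<longlongrightarrow> A) at_bot"
proof -
  define w0 where "w0 = (4 * \<mu>\<^sub>2) powr (- (1/4))"
  have w0: "w0 > 0" using \<mu>\<^sub>2 by (simp add: w0_def)
  have "w0 ^ 4 = w0 powr 4" using w0 powr_realpow[of w0 4] by simp
  also have "\<dots> = (4 * \<mu>\<^sub>2) powr (- 1)" by (simp add: w0_def powr_powr)
  also have "\<dots> = 1 / (4 * \<mu>\<^sub>2)" using \<mu>\<^sub>2 by (simp add: powr_minus_divide)
  finally have "\<mu>\<^sub>2 * w0 ^ 4 = 1 / 4" using \<mu>\<^sub>2 by simp
  then have w04: "\<mu>\<^sub>2 * w0 ^ 4 * c = c / 4" for c by simp
  \<comment> \<open>With $s = \varepsilon\rho$, $w = w_0 + s a$ and $z = s b$, the terms of the equations that are not linear in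
    $(w - w_0, z)$ are $-s^2 G$ and $-s^2 H$; here $\mu_2 w_0^4 = 1/4$ is used.\<close>
  define G :: "real \<Rightarrow> real \<times> real \<Rightarrow> real" where
    "G s p = \<mu>\<^sub>2 * (10 * w0^3 * fst p ^ 2 + 10 * w0^2 * s * fst p ^ 3 + 5 * w0 * s^2 * fst p ^ 4 + s^3 * fst p ^ 5)
       + \<beta> * (w0 + s * fst p)^2 * s * snd p ^ 3" for s p
  define H :: "real \<Rightarrow> real \<times> real \<Rightarrow> real" where
    "H s p = \<mu>\<^sub>1 * s^3 * snd p ^ 5 + \<beta> * snd p ^ 2 * (w0 + s * fst p)^3" for s p
  define B :: "(real \<times> real) set" where "B = cball (0, 1) (1/2)"
  have bB: "bounded B" by (simp add: B_def)
  have ids: "bounded ((\<lambda>x. c) ` {0..2::real})" "bounded ((\<lambda>x. x) ` {0..2::real})" for c :: real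
    by (auto simp: image_constant_conv)
  have "bounded_lipschitz {0..2} B G"
    unfolding G_def[abs_def] by (intro bounded_lipschitz_intros ids bB)
  then obtain K1 where K1: "0 \<le> K1" "\<And>z p. z \<in> {0..2} \<Longrightarrow> p \<in> B \<Longrightarrow> \<bar>G z p\<bar> \<le> K1"
    "\<And>z p q. z \<in> {0..2} \<Longrightarrow> p \<in> B \<Longrightarrow> q \<in> B \<Longrightarrow> \<bar>G z p - G z q\<bar> \<le> K1 * dist p q"
    using bounded_lipschitzE by blast
  have "bounded_lipschitz {0..2} B H"
    unfolding H_def[abs_def] by (intro bounded_lipschitz_intros ids bB)
  then obtain K2 where K2: "0 \<le> K2" "\<And>z p. z \<in> {0..2} \<Longrightarrow> p \<in> B \<Longrightarrow> \<bar>H z p\<bar> \<le> K2"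
    "\<And>z p q. z \<in> {0..2} \<Longrightarrow> p \<in> B \<Longrightarrow> q \<in> B \<Longrightarrow> \<bar>H z p - H z q\<bar> \<le> K2 * dist p q"
    using bounded_lipschitzE by blast
  define K where "K = max K1 K2"
  have K: "K1 \<le> K" "K2 \<le> K" "0 \<le> K" using K1(1) by (auto simp: K_def)
  \<comment> \<open>The three bounds keep $\varepsilon\sigma$ in $[0, 2]$, keep $w$ positive, and make the
    Volterra operator a contraction.\<close>
  define \<epsilon> where "\<epsilon> = min (min 1 (w0 / 2)) (1 / (32 * (K + 1)))"
  have \<epsilon>: "0 < \<epsilon>" "\<epsilon> \<le> 1" "\<epsilon> < w0" using K w0 by (auto simp: \<epsilon>_def)
  have "32 * \<epsilon> * K \<le> 32 * (1 / (32 * (K + 1))) * K"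
    using K by (intro mult_right_mono mult_left_mono) (auto simp: \<epsilon>_def)
  also have "\<dots> \<le> 1" using K by (simp add: field_simps)
  finally have \<epsilon>K: "32 * \<epsilon> * K \<le> 1" .
  have rng: "\<epsilon> * \<sigma> \<in> {0..2}" if "\<sigma> \<in> {0..2}" for \<sigma>
    using mult_mono[of \<epsilon> 1 \<sigma> 2] that \<epsilon> by auto
  have GH_cont: "continuous_on {0..2} (\<lambda>\<sigma>. G (\<epsilon> * \<sigma>) (P \<sigma>))" "continuous_on {0..2} (\<lambda>\<sigma>. H (\<epsilon> * \<sigma>) (P \<sigma>))"
    if "continuous_on {0..2} P" for P
    unfolding G_def H_def by (intro continuous_intros that)+
  have lip: "c * dist p q \<le> K * dist p q" if "c \<le> K" for c and p q :: "real \<times> real"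
    using that by (intro mult_right_mono) auto
  obtain P where P: "continuous_on {0..2} P" "\<And>\<rho>. \<rho> \<in> {0..2} \<Longrightarrow> P \<rho> \<in> B"
    "\<And>\<rho>. \<rho> \<in> {0..2} \<Longrightarrow> P \<rho> = (0, 1) -
        \<epsilon> *\<^sub>R (osc (\<lambda>\<sigma>. G (\<epsilon> * \<sigma>) (P \<sigma>)) \<rho>, pot (\<lambda>\<sigma>. H (\<epsilon> * \<sigma>) (P \<sigma>)) \<rho>)"
  proof (rule volterra_fixed_point[of "\<lambda>\<sigma>. G (\<epsilon> * \<sigma>)" "\<lambda>\<sigma>. H (\<epsilon> * \<sigma>)" "(0, 1)" K \<epsilon>, folded B_def])
    fix \<sigma> :: real and p q assume *: "\<sigma> \<in> {0..2}" "p \<in> B"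
    show "\<bar>G (\<epsilon> * \<sigma>) p\<bar> \<le> K" using K1(2)[OF rng[OF *(1)] *(2)] K by simp
    show "\<bar>H (\<epsilon> * \<sigma>) p\<bar> \<le> K" using K2(2)[OF rng[OF *(1)] *(2)] K by simp
    assume q: "q \<in> B"
    show "\<bar>G (\<epsilon> * \<sigma>) p - G (\<epsilon> * \<sigma>) q\<bar> \<le> K * dist p q"
      by (rule order_trans[OF K1(3)[OF rng[OF *(1)] *(2) q] lip[OF K(1)]])
    show "\<bar>H (\<epsilon> * \<sigma>) p - H (\<epsilon> * \<sigma>) q\<bar> \<le> K * dist p q"
      by (rule order_trans[OF K2(3)[OF rng[OF *(1)] *(2) q] lip[OF K(2)]])
  next
    fix Q assume "continuous_on {0..2} Q" "\<And>\<rho>. \<rho> \<in> {0..2} \<Longrightarrow> Q \<rho> \<in> B"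
      "\<And>\<rho>. \<rho> \<in> {0..2} \<Longrightarrow> Q \<rho> = (0, 1) -
        \<epsilon> *\<^sub>R (osc (\<lambda>\<sigma>. G (\<epsilon> * \<sigma>) (Q \<sigma>)) \<rho>, pot (\<lambda>\<sigma>. H (\<epsilon> * \<sigma>) (Q \<sigma>)) \<rho>)"
    then show thesis by (rule that)
  qed (use GH_cont \<epsilon> \<epsilon>K in auto)
  define g where "g \<sigma> = G (\<epsilon> * \<sigma>) (P \<sigma>)" for \<sigma>
  define h where "h \<sigma> = H (\<epsilon> * \<sigma>) (P \<sigma>)" for \<sigma>
  have g: "continuous_on {0..2} g" and h: "continuous_on {0..2} h"
    using GH_cont[OF P(1)] by (simp_all add: g_def[abs_def] h_def[abs_def])
  have h2: "continuous_on {0..2} (\<lambda>\<sigma>. \<sigma>\<^sup>2 * h \<sigma>)" by (intro continuous_intros h)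
  have hK: "\<bar>h \<sigma>\<bar> \<le> K" if "\<sigma> \<in> {0..2}" for \<sigma>
    using K2(2)[OF rng[OF that] P(2)[OF that]] K by (simp add: h_def)
  have fP: "fst (P \<rho>) = - \<epsilon> * osc g \<rho>" and sP: "snd (P \<rho>) = 1 - \<epsilon> * pot h \<rho>" if "\<rho> \<in> {0..2}" for \<rho>
    using arg_cong[OF P(3)[OF that], of fst] arg_cong[OF P(3)[OF that], of snd]
    by (simp_all add: g_def[abs_def] h_def[abs_def])
  define C where "C t = integral {0..exp (t/2)} (\<lambda>\<sigma>. \<sigma> * cos (2 * ln \<sigma>) * g \<sigma>)" for t
  define S where "S t = integral {0..exp (t/2)} (\<lambda>\<sigma>. \<sigma> * sin (2 * ln \<sigma>) * g \<sigma>)" for t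
  define N where "N t = integral {0..exp (t/2)} h" for t
  define M where "M t = integral {0..exp (t/2)} (\<lambda>\<sigma>. \<sigma>\<^sup>2 * h \<sigma>)" for t
  \<comment> \<open>The functions $w = w_0 + \varepsilon\rho\psi$ and $z = \varepsilon\rho U$, written out in terms of the four
    integrals, which makes their differentiability visible.\<close>
  define w where "w t = w0 - 2 * \<epsilon>\<^sup>2 * (sin t * C t - cos t * S t)" for t
  define w' where "w' t = - 2 * \<epsilon>\<^sup>2 * (cos t * C t + sin t * S t)" for t
  define z where "z t = \<epsilon> * exp (t/2) - 2 * \<epsilon>\<^sup>2 * (exp (t/2) * N t - exp (- (t/2)) * M t)" for t
  define z' where "z' t = z t / 2 - 2 * \<epsilon>\<^sup>2 * (exp (- (t/2)) * M t)" for t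
  have exp_rng: "exp (t/2) < 2" if "t < 1" for t :: real
  proof -
    have "exp (t/2) < exp (1/2)" using that by simp
    also have "\<dots> \<le> 2" using exp_bound_half[of "1/2::real"] by simp
    finally show ?thesis .
  qed
  have exp_in: "exp (t/2) \<in> {0..2}" if "t < 1" for t :: real using exp_rng[OF that] by simp
  have exp_sq: "exp (t/2) ^ 2 = exp t" "exp (t/2) * exp (t/2) = exp t" for t :: real
    by (simp_all add: power2_eq_square flip: exp_add)
  \<comment> \<open>Here $2 \ln e^{t/2} = t$ identifies the trigonometric factors.\<close>
  have w_eq: "w t = w0 + \<epsilon> * exp (t/2) * fst (P (exp (t/2)))" if "t < 1" for t
    unfolding fP[OF exp_in[OF that]] w_def osc_def C_def S_def
    by (simp add: power2_eq_square)
  have z_eq: "z t = \<epsilon> * exp (t/2) * snd (P (exp (t/2)))" if "t < 1" for t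
    unfolding sP[OF exp_in[OF that]] z_def pot_def N_def M_def
    by (simp add: power2_eq_square field_simps exp_minus)
  have PB: "\<bar>fst p\<bar> \<le> 1/2" "\<bar>snd p - 1\<bar> \<le> 1/2" if "p \<in> B" for p
  proof -
    have "dist p (0, 1) \<le> 1/2" using that by (simp add: B_def dist_commute)
    then show "\<bar>fst p\<bar> \<le> 1/2" "\<bar>snd p - 1\<bar> \<le> 1/2"
      using dist_fst_le[of p "(0, 1)"] dist_snd_le[of p "(0, 1)"] by (simp_all add: dist_real_def)
  qed
  have w_pos: "0 < w t" if "t < 1" for t
  proof -
    have "\<bar>\<epsilon> * exp (t/2) * fst (P (exp (t/2)))\<bar> \<le> \<epsilon> * 2 * (1/2)"
      unfolding abs_mult using \<epsilon> exp_rng[OF that] PB[OF P(2)[OF exp_in[OF that]]]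
      by (intro mult_mono) auto
    then show ?thesis unfolding w_eq[OF that] using \<epsilon> by linarith
  qed
  have z_pos: "0 < z t" if "t < 1" for t
  proof -
    have "0 < snd (P (exp (t/2)))" using PB(2)[OF P(2)[OF exp_in[OF that]]] by linarith
    then show ?thesis unfolding z_eq[OF that] using \<epsilon> by simp
  qed
  have dC: "(C has_real_derivative exp t / 2 * cos t * g (exp (t/2))) (at t)"
    and dS: "(S has_real_derivative exp t / 2 * sin t * g (exp (t/2))) (at t)"
    and dN: "(N has_real_derivative exp (t/2) / 2 * h (exp (t/2))) (at t)"
    and dM: "(M has_real_derivative exp t / 2 * exp (t/2) * h (exp (t/2))) (at t)" if "t < 1" for t
    using integral_exp_half_derivative[OF osc_integrands(1)[OF g] exp_rng[OF that]]
      integral_exp_half_derivative[OF osc_integrands(2)[OF g] exp_rng[OF that]]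
      integral_exp_half_derivative[OF h exp_rng[OF that]]
      integral_exp_half_derivative[OF h2 exp_rng[OF that]]
    unfolding C_def[abs_def] S_def[abs_def] N_def[abs_def] M_def[abs_def]
    by (simp_all add: exp_sq(2)[of t, symmetric] power2_eq_square mult_ac)
  have dw: "(w has_real_derivative w' t) (at t)" if "t < 1" for t
    unfolding w_def[abs_def] w'_def
    by (rule derivative_eq_intros dC[OF that] dS[OF that] refl)+ (simp add: algebra_simps)
  have dw': "(w' has_real_derivative - (w t - w0) - \<epsilon>\<^sup>2 * exp t * g (exp (t/2))) (at t)" if "t < 1" for t
  proof -
    have sc: "sin t * (sin t * x) = x - cos t * (cos t * x)" for x
      using sin_cos_squared_add[of t] unfolding power2_eq_square by algebra
    show ?thesis
      unfolding w_def w'_def[abs_def]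
      by (rule derivative_eq_intros dC[OF that] dS[OF that] refl)+ (simp add: algebra_simps sc; simp add: field_simps)
  qed
  have dexp: "((\<lambda>t. exp (t/2)) has_real_derivative exp (t/2) / 2) (at t)"
    and dexp': "((\<lambda>t. exp (- (t/2))) has_real_derivative - exp (- (t/2)) / 2) (at t)" for t :: real
    by (auto intro!: derivative_eq_intros)
  have e: "exp (- (t/2)) * (exp t * x) = exp (t/2) * x" "exp (t/2) * (exp (t/2) * x) = exp t * x"
    "exp (t/2) * (exp (- (t/2)) * x) = x" for t x :: real
    by (simp_all add: mult.assoc[symmetric] flip: exp_add)
  have dz: "(z has_real_derivative z' t) (at t)" if "t < 1" for t
  proof -
    have "(z has_real_derivative \<epsilon> * (exp (t/2) / 2) - 2 * \<epsilon>\<^sup>2 *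
        ((exp (t/2) / 2 * N t + (exp (t/2) / 2 * h (exp (t/2))) * exp (t/2))
         - (- exp (- (t/2)) / 2 * M t + (exp t / 2 * exp (t/2) * h (exp (t/2))) * exp (- (t/2))))) (at t)"
      unfolding z_def[abs_def]
      by (intro DERIV_diff DERIV_cmult DERIV_mult dexp dexp' dN[OF that] dM[OF that])
    then show ?thesis
      by (rule DERIV_cong) (simp add: z'_def z_def algebra_simps e; simp add: field_simps)
  qed
  have dz': "(z' has_real_derivative z t / 4 - \<epsilon>\<^sup>2 * exp t * h (exp (t/2))) (at t)" if "t < 1" for t
  proof -
    have "(z' has_real_derivative z' t / 2 - 2 * \<epsilon>\<^sup>2 *
        (- exp (- (t/2)) / 2 * M t + (exp t / 2 * exp (t/2) * h (exp (t/2))) * exp (- (t/2)))) (at t)"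
      unfolding z'_def[abs_def]
      by (intro DERIV_diff DERIV_cmult DERIV_mult DERIV_cdivide dexp' dM[OF that] dz[OF that, unfolded z'_def])
    then show ?thesis
      by (rule DERIV_cong) (simp add: z'_def algebra_simps e; simp add: field_simps)
  qed
  have ode_w: "- (w t - w0) - \<epsilon>\<^sup>2 * exp t * g (exp (t/2)) = w t / 4 - \<mu>\<^sub>2 * w t ^ 5 - \<beta> * w t ^ 2 * z t ^ 3"
    if "t < 1" for t
  proof -
    define a b s where "a = fst (P (exp (t/2)))" and "b = snd (P (exp (t/2)))" and "s = \<epsilon> * exp (t/2)"
    have w: "w t = w0 + s * a" and z: "z t = s * b"
      using w_eq[OF that] z_eq[OF that] by (simp_all add: a_def b_def s_def)
    have s2: "\<epsilon>\<^sup>2 * exp t = s\<^sup>2" by (simp add: s_def power_mult_distrib exp_sq)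
    have gg: "g (exp (t/2)) = \<mu>\<^sub>2 * (10 * w0^3 * a ^ 2 + 10 * w0^2 * s * a ^ 3 + 5 * w0 * s^2 * a ^ 4 + s^3 * a ^ 5)
       + \<beta> * (w0 + s * a)^2 * s * b ^ 3"
      by (simp add: g_def G_def a_def b_def s_def)
    have "\<mu>\<^sub>2 * (w0 + s * a) ^ 5 = \<mu>\<^sub>2 * w0 ^ 4 * w0 + 5 * (\<mu>\<^sub>2 * w0 ^ 4 * (s * a)) + s\<^sup>2 *
       (\<mu>\<^sub>2 * (10 * w0^3 * a ^ 2 + 10 * w0^2 * s * a ^ 3 + 5 * w0 * s^2 * a ^ 4 + s^3 * a ^ 5))"
      by algebra
    also have "\<mu>\<^sub>2 * w0 ^ 4 * w0 = w0 / 4" by (rule w04)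
    also have "\<mu>\<^sub>2 * w0 ^ 4 * (s * a) = s * a / 4" by (rule w04)
    finally have e5: "\<mu>\<^sub>2 * (w0 + s * a) ^ 5 = w0 / 4 + 5 * (s * a / 4) + s\<^sup>2 *
       (\<mu>\<^sub>2 * (10 * w0^3 * a ^ 2 + 10 * w0^2 * s * a ^ 3 + 5 * w0 * s^2 * a ^ 4 + s^3 * a ^ 5))" .
    have e3: "\<beta> * (w0 + s * a)\<^sup>2 * (s * b) ^ 3 = s\<^sup>2 * (\<beta> * (w0 + s * a)^2 * s * b ^ 3)" by algebra
    show ?thesis unfolding s2 w z gg e5 e3 by (simp add: distrib_left; simp add: field_simps)
  qed
  have ode_z: "z t / 4 - \<epsilon>\<^sup>2 * exp t * h (exp (t/2)) = z t / 4 - \<mu>\<^sub>1 * z t ^ 5 - \<beta> * z t ^ 2 * w t ^ 3"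
    if "t < 1" for t
  proof -
    define a b s where "a = fst (P (exp (t/2)))" and "b = snd (P (exp (t/2)))" and "s = \<epsilon> * exp (t/2)"
    have w: "w t = w0 + s * a" and z: "z t = s * b"
      using w_eq[OF that] z_eq[OF that] by (simp_all add: a_def b_def s_def)
    have s2: "\<epsilon>\<^sup>2 * exp t = s\<^sup>2" by (simp add: s_def power_mult_distrib exp_sq)
    have hh: "h (exp (t/2)) = \<mu>\<^sub>1 * s^3 * b ^ 5 + \<beta> * b ^ 2 * (w0 + s * a)^3"
      by (simp add: h_def H_def a_def b_def s_def)
    show ?thesis unfolding s2 w z hh by algebra
  qed
  have lC: "(C \<longlongrightarrow> 0) at_bot" and lS: "(S \<longlongrightarrow> 0) at_bot" and lN: "(N \<longlongrightarrow> 0) at_bot"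
    unfolding C_def S_def N_def
    by (rule tendsto_integral_exp_half[of 2]; simp add: osc_integrands g h)+
  have lt1: "\<forall>\<^sub>F t in at_bot. t < (1::real)" by (rule eventually_gt_at_bot)
  have le: "((\<lambda>t::real. exp (t/2)) \<longlongrightarrow> 0) at_bot"
    using tendsto_exp_half_at_bot unfolding filterlim_at by simp
  have lpot: "((\<lambda>t. pot h (exp (t/2))) \<longlongrightarrow> 0) at_bot"
  proof (rule Lim_null_comparison)
    show "\<forall>\<^sub>F t in at_bot. norm (pot h (exp (t/2))) \<le> 4 * K * exp (t/2)"
      using lt1
    proof eventually_elim
      case (elim t)
      have "continuous_on {0..exp (t/2)} h"
        by (rule continuous_on_subset[OF h]) (use exp_in[OF elim] in auto)
      then show ?case using exp_in[OF elim] by (auto intro!: pot_bound hK)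
    qed
    show "((\<lambda>t. 4 * K * exp (t/2)) \<longlongrightarrow> 0) at_bot"
      using tendsto_mult_left[OF le, of "4 * K"] by simp
  qed
  have lM: "((\<lambda>t. exp (- (t/2)) * M t) \<longlongrightarrow> 0) at_bot"
  proof -
    have "exp (- (t/2)) * M t = exp (t/2) * (N t - pot h (exp (t/2)) / 2)" for t
      by (simp add: N_def M_def pot_def power2_eq_square exp_minus field_simps)
    moreover have "((\<lambda>t. exp (t/2) * (N t - pot h (exp (t/2)) / 2)) \<longlongrightarrow> 0 * (0 - 0 / 2)) at_bot"
      by (intro tendsto_intros le lN lpot) auto
    ultimately show ?thesis by simp
  qed
  have lsin: "((\<lambda>t. sin t * f t) \<longlongrightarrow> 0) at_bot" and lcos: "((\<lambda>t. cos t * f t) \<longlongrightarrow> 0) at_bot"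
    if "(f \<longlongrightarrow> 0) at_bot" for f :: "real \<Rightarrow> real"
    by (rule Lim_null_comparison[OF always_eventually tendsto_norm_zero[OF that]];
        simp add: abs_mult mult_left_le_one_le)+
  have lw: "(w \<longlongrightarrow> w0) at_bot"
    unfolding w_def[abs_def]
    using tendsto_diff[OF tendsto_const[of w0] tendsto_mult_left[OF tendsto_diff[OF lsin[OF lC] lcos[OF lS]], of "2 * \<epsilon>\<^sup>2"]] by simp
  have lw': "(w' \<longlongrightarrow> 0) at_bot"
    unfolding w'_def[abs_def]
    using tendsto_mult_left[OF tendsto_add[OF lcos[OF lC] lsin[OF lS]], of "-2 * \<epsilon>\<^sup>2"] by simp
  have lz: "(z \<longlongrightarrow> 0) at_bot"
    unfolding z_def[abs_def]
    using tendsto_diff[OF tendsto_mult_left[OF le, of \<epsilon>]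
      tendsto_mult_left[OF tendsto_diff[OF tendsto_mult[OF le lN] lM], of "2 * \<epsilon>\<^sup>2"]] by simp
  have lz': "(z' \<longlongrightarrow> 0) at_bot"
    unfolding z'_def[abs_def]
    using tendsto_diff[OF tendsto_divide[OF lz tendsto_const[of 2]] tendsto_mult_left[OF lM, of "2 * \<epsilon>\<^sup>2"]] by simp
  have lA: "((\<lambda>t. exp (- (t/2)) * z t) \<longlongrightarrow> \<epsilon>) at_bot"
  proof -
    have "((\<lambda>t. \<epsilon> * (1 - \<epsilon> * pot h (exp (t/2)))) \<longlongrightarrow> \<epsilon> * (1 - \<epsilon> * 0)) at_bot"
      by (intro tendsto_intros lpot)
    moreover have "\<forall>\<^sub>F t in at_bot. \<epsilon> * (1 - \<epsilon> * pot h (exp (t/2))) = exp (- (t/2)) * z t"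
      using lt1
    proof eventually_elim
      case (elim t)
      show ?case unfolding z_eq[OF elim] sP[OF exp_in[OF elim]] by (simp add: exp_minus)
    qed
    ultimately show ?thesis by (simp add: tendsto_cong)
  qed
  show thesis
    by (rule that[of w z w' z' \<epsilon>])
      (use w_pos z_pos dw dw' dz dz' ode_w ode_z lw lw' lz lz' lA \<epsilon> in \<open>simp_all add: w0_def\<close>)
qed

section \<open>Radial functions on a punctured ball\<close>

lemma partial_eq:
  assumes "(f has_derivative D) (at x)"
  shows "partial i f x = D (axis i 1)"
  unfolding partial_def using frechet_derivative_at[OF assms] by simp

lemma has_derivative_radial:
  fixes x :: "real^3"
  assumes "(F has_real_derivative d) (at (norm x))" "x \<noteq> 0"
  shows "((\<lambda>y. F (norm y)) has_derivative (\<lambda>h. d / norm x * (x \<bullet> h))) (at x)"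
proof -
  have "((\<lambda>y. F (norm y)) has_derivative (\<lambda>h. d * (h \<bullet> sgn x))) (at x)"
    using has_derivative_compose[OF has_derivative_norm[OF assms(2)]
        assms(1)[unfolded has_field_derivative_def]] by simp
  then show ?thesis by (simp add: sgn_div_norm inner_commute divide_inverse mult_ac)
qed

lemma has_derivative_radial_component:
  fixes x :: "real^3"
  assumes "(F has_real_derivative d) (at (norm x))" "x \<noteq> 0"
  shows "((\<lambda>y. F (norm y) * y $ i) has_derivative
           (\<lambda>h. F (norm x) * h $ i + d / norm x * (x \<bullet> h) * x $ i)) (at x)"
  by (rule has_derivative_mult[OF has_derivative_radial[OF assms]
        bounded_linear_imp_has_derivative[OF bounded_linear_vec_nth]])

lemma continuous_on_radial:
  fixes F :: "real \<Rightarrow> real"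
  assumes "continuous_on {0<..<R} F"
  shows "continuous_on (ball 0 R - {0::real^3}) (\<lambda>x. F (norm x))"
  by (rule continuous_on_compose2[OF assms]) (auto intro!: continuous_intros)

context
  fixes F F' F'' :: "real \<Rightarrow> real" and R :: real
  assumes F: "\<And>r. 0 < r \<Longrightarrow> r < R \<Longrightarrow> (F has_real_derivative F' r) (at r)"
    and F': "\<And>r. 0 < r \<Longrightarrow> r < R \<Longrightarrow> (F' has_real_derivative F'' r) (at r)"
begin

lemma radial_grad:
  assumes "x \<in> ball 0 R - {0::real^3}"
  shows "partial i (\<lambda>y. F (norm y)) x = F' (norm x) / norm x * x $ i"
    and "grad (\<lambda>y. F (norm y)) x = (F' (norm x) / norm x) *\<^sub>R x"
proof -
  have x: "x \<noteq> 0" "0 < norm x" "norm x < R" using assms by auto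
  show "partial i (\<lambda>y. F (norm y)) x = F' (norm x) / norm x * x $ i" for i
    unfolding partial_eq[OF has_derivative_radial[OF F[OF x(2,3)] x(1)]]
    by (simp add: inner_axis)
  then show "grad (\<lambda>y. F (norm y)) x = (F' (norm x) / norm x) *\<^sub>R x"
    by (simp add: grad_def vec_eq_iff)
qed

lemma radial_second_derivative:
  assumes "x \<in> ball 0 R - {0::real^3}"
  shows "(partial i (\<lambda>y. F (norm y)) has_derivative
     (\<lambda>h. F' (norm x) / norm x * h $ i
        + (F'' (norm x) - F' (norm x) / norm x) / (norm x)\<^sup>2 * (x \<bullet> h) * x $ i)) (at x)"
proof -
  have x: "x \<noteq> 0" "0 < norm x" "norm x < R" using assms by auto
  have "((\<lambda>r. F' r / r) has_real_derivative (F'' (norm x) - F' (norm x) / norm x) / norm x) (at (norm x))"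
    using x by (auto intro!: derivative_eq_intros F' simp: field_simps power2_eq_square)
  from has_derivative_radial_component[OF this x(1), of i]
  have "((\<lambda>y. F' (norm y) / norm y * y $ i) has_derivative
     (\<lambda>h. F' (norm x) / norm x * h $ i
        + (F'' (norm x) - F' (norm x) / norm x) / (norm x)\<^sup>2 * (x \<bullet> h) * x $ i)) (at x)"
    by (simp add: power2_eq_square)
  then show ?thesis
    by (rule has_derivative_transform_within_open[where s = "ball 0 R - {0}"])
      (use assms radial_grad(1) in auto)
qed

lemma radial_laplacian:
  assumes "x \<in> ball 0 R - {0::real^3}"
  shows "laplacian (\<lambda>y. F (norm y)) x = F'' (norm x) + 2 * F' (norm x) / norm x"
proof -
  have x: "x \<noteq> 0" using assms by auto
  have n: "(norm x)\<^sup>2 = x $ 1 * x $ 1 + x $ 2 * x $ 2 + x $ 3 * x $ 3"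
    by (simp add: power2_norm_eq_inner inner_vec_def sum_3)
  have "laplacian (\<lambda>y. F (norm y)) x
      = 3 * (F' (norm x) / norm x) + (F'' (norm x) - F' (norm x) / norm x) / (norm x)\<^sup>2 * (norm x)\<^sup>2"
    unfolding laplacian_def partial_eq[OF radial_second_derivative[OF assms]]
    by (simp add: inner_axis sum_3 n distrib_left)
  also have "\<dots> = F'' (norm x) + 2 * F' (norm x) / norm x" using x by simp
  finally show ?thesis .
qed

lemma radial_C2_on:
  assumes "continuous_on {0<..<R} F''"
  shows "C2_on (ball 0 R - {0}) (\<lambda>x. F (norm x))"
proof -
  define S where "S = ball 0 R - {0::real^3}"
  have c': "continuous_on {0<..<R} F'"
    by (intro continuous_at_imp_continuous_on ballI, rule DERIV_isCont, rule F') auto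
  have cF': "continuous_on S (\<lambda>x. F' (norm x) / norm x)"
    and cF'': "continuous_on S (\<lambda>x. F'' (norm x))"
    unfolding S_def using continuous_on_radial[OF c'] continuous_on_radial[OF assms]
    by (auto intro!: continuous_intros)
  have diff: "(\<lambda>y. F (norm y)) differentiable_on S"
  proof (rule differentiable_at_imp_differentiable_on)
    fix x :: "real^3" assume "x \<in> S"
    then have "0 < norm x" "norm x < R" "x \<noteq> 0" by (auto simp: S_def)
    then show "(\<lambda>y. F (norm y)) differentiable (at x)"
      by - (rule differentiableI, rule has_derivative_radial, rule F)
  qed
  have diff': "partial i (\<lambda>y. F (norm y)) differentiable_on S" for i
    using radial_second_derivative unfolding S_def
    by (intro differentiable_at_imp_differentiable_on) (rule differentiableI)
  have cont1: "continuous_on S (partial i (\<lambda>y. F (norm y)))" for i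
    using diff' by (rule differentiable_imp_continuous_on)
  have cont2: "continuous_on S (partial j (partial i (\<lambda>y. F (norm y))))" for i j
  proof -
    have "continuous_on S (\<lambda>x. F' (norm x) / norm x * axis j 1 $ i
        + (F'' (norm x) - F' (norm x) / norm x) / (norm x)\<^sup>2 * (x $ j) * x $ i)"
      by (intro continuous_intros cF' cF'') (auto simp: S_def)
    then show ?thesis
      by (rule continuous_on_eq)
        (simp add: partial_eq[OF radial_second_derivative] S_def inner_axis)
  qed
  show ?thesis
    using diff diff' cont1 cont2 unfolding C2_on_def C1_on_def S_def by blast
qed

lemma radial_normal_deriv:
  assumes "x \<in> ball 0 R - {0::real^3}"
  shows "normal_deriv (\<lambda>y. F (norm y)) x = F' (norm x)"
    and "norm (grad (\<lambda>y. F (norm y)) x) = \<bar>F' (norm x)\<bar>"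
  using assms by (auto simp: normal_deriv_def radial_grad(2) power2_norm_eq_inner[symmetric] power2_eq_square)

end

section \<open>Integrals over spheres\<close>

lemma norm_spherical: "norm (spherical r \<theta> \<phi>) = \<bar>r\<bar>"
proof -
  have "(norm (spherical r \<theta> \<phi>))\<^sup>2
      = r\<^sup>2 * ((sin \<theta>)\<^sup>2 * ((cos \<phi>)\<^sup>2 + (sin \<phi>)\<^sup>2) + (cos \<theta>)\<^sup>2)"
    unfolding power2_norm_eq_inner inner_vec_def sum_3 spherical_def
    by (simp only: inner_real_def vector_3) algebra
  also have "\<dots> = \<bar>r\<bar>\<^sup>2" by simp
  finally show ?thesis by (rule power2_eq_imp_eq) auto
qed

lemma sphere_integral_const:
  assumes f: "\<And>x. norm x = r \<Longrightarrow> f x = c" and r: "0 \<le> r"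
  shows "sphere_integral r f = 4 * pi * r\<^sup>2 * c"
proof -
  let ?g = "\<lambda>p :: real \<times> real. c * (r\<^sup>2 * sin (fst p))"
  let ?S = "cbox (0, 0) (pi, 2 * pi) :: (real \<times> real) set"
  have S: "{0..pi} \<times> {0..2 * pi} = ?S" by (simp add: cbox_Pair_eq)
  have f: "f (spherical r \<theta> \<phi>) = c" for \<theta> \<phi>
    by (rule f) (simp add: norm_spherical r)
  have cont: "continuous_on ?S ?g" by (intro continuous_intros)
  have "sphere_integral r f = (LINT p : ?S | lborel. ?g p)"
    unfolding sphere_integral_def S f by (simp add: case_prod_unfold)
  also have "\<dots> = integral ?S ?g"
    by (rule set_borel_integral_eq_integral(2))
      (simp only: set_integrable_def borel_integrable_compact[OF compact_cbox cont])
  also have "\<dots> = integral {0..pi} (\<lambda>\<theta>. integral {0..2 * pi} (\<lambda>\<phi>. c * (r\<^sup>2 * sin \<theta>)))"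
    using integral_prod_continuous[OF cont] by simp
  also have "\<dots> = integral {0..pi} (\<lambda>\<theta>. (2 * pi * c * r\<^sup>2) * sin \<theta>)"
    by (simp add: mult_ac)
  also have "\<dots> = 2 * pi * c * r\<^sup>2 * 2"
  proof (rule integral_unique)
    have "((\<lambda>\<theta>. 2 * pi * c * r\<^sup>2 * sin \<theta>) has_integral
        - (2 * pi * c * r\<^sup>2) * cos pi - - (2 * pi * c * r\<^sup>2) * cos 0) {0..pi}"
      by (rule fundamental_theorem_of_calculus)
        (auto intro!: derivative_eq_intros simp flip: has_real_derivative_iff_has_vector_derivative)
    then show "((\<lambda>\<theta>. 2 * pi * c * r\<^sup>2 * sin \<theta>) has_integral 2 * pi * c * r\<^sup>2 * 2) {0..pi}"
      by simp
  qed
  finally show ?thesis by simp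
qed

section \<open>The Emden--Fowler transformation\<close>

text \<open>The radial profile $r^{-1/2} w(\ln r)$.\<close>

definition emden_fowler :: "(real \<Rightarrow> real) \<Rightarrow> real \<Rightarrow> real" where
  "emden_fowler w r = exp (- (ln r / 2)) * w (ln r)"

lemma exp_half_ln:
  fixes r :: real
  assumes "0 < r"
  shows "exp (- (ln r / 2)) ^ 4 * r\<^sup>2 = 1" "exp (- (ln r / 2)) ^ 2 * r = 1"
proof -
  have "exp (- (ln r / 2)) ^ 2 = exp (- ln r)" by (simp add: power2_eq_square flip: exp_add)
  then show *: "exp (- (ln r / 2)) ^ 2 * r = 1" using assms by (simp add: exp_minus)
  then have "(exp (- (ln r / 2)) ^ 2 * r)\<^sup>2 = 1" by simp
  then show "exp (- (ln r / 2)) ^ 4 * r\<^sup>2 = 1" by (simp add: power_mult_distrib flip: power_mult)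
qed

lemma emden_fowler_derivatives:
  assumes r: "0 < r" and w: "(w has_real_derivative w' (ln r)) (at (ln r))"
  shows "(emden_fowler w has_real_derivative emden_fowler (\<lambda>t. w' t - w t / 2) r / r) (at r)"
    and "(w' has_real_derivative w'' (ln r)) (at (ln r)) \<Longrightarrow>
      ((\<lambda>r. emden_fowler (\<lambda>t. w' t - w t / 2) r / r) has_real_derivative
         emden_fowler (\<lambda>t. w'' t - 2 * w' t + 3 * w t / 4) r / r\<^sup>2) (at r)"
proof -
  have e: "((\<lambda>r. exp (- (ln r / 2))) has_real_derivative - exp (- (ln r / 2)) / (2 * r)) (at r)"
    using r by (auto intro!: derivative_eq_intros simp: field_simps)
  have comp: "((\<lambda>r. f (ln r)) has_real_derivative d * (1 / r)) (at r)"
    if "(f has_real_derivative d) (at (ln r))" for f d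
    by (rule DERIV_chain2[where g = ln, OF that DERIV_ln_divide[OF r]])
  show "(emden_fowler w has_real_derivative emden_fowler (\<lambda>t. w' t - w t / 2) r / r) (at r)"
    unfolding emden_fowler_def
    by (rule DERIV_cong[OF DERIV_mult[OF e comp[OF w]]]) (use r in \<open>simp add: field_simps\<close>)
  assume w': "(w' has_real_derivative w'' (ln r)) (at (ln r))"
  have i: "((\<lambda>r. r) has_real_derivative 1) (at r)" by (rule DERIV_ident)
  show "((\<lambda>r. emden_fowler (\<lambda>t. w' t - w t / 2) r / r) has_real_derivative
         emden_fowler (\<lambda>t. w'' t - 2 * w' t + 3 * w t / 4) r / r\<^sup>2) (at r)"
    unfolding emden_fowler_def
    by (rule DERIV_cong[OF DERIV_divide[OF DERIV_mult[OF e
          DERIV_diff[OF comp[OF w'] DERIV_cdivide[OF comp[OF w]]]] i]])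
      (use r in \<open>simp_all add: field_simps power2_eq_square\<close>)
qed

text \<open>
  The radial Laplacian $F'' + 2 F'/r$ of the profile $F$ of $w$, with the second derivative of $w$
  replaced by its value from the autonomous system. The summand $w/4$ of that value cancels in
  $r^{-5/2} (w'' - w/4)$.
\<close>

lemma emden_fowler_equation:
  assumes "0 < r"
  shows "emden_fowler (\<lambda>t. w t / 4 - a * w t ^ 5 - b * w t ^ 2 * z t ^ 3 - 2 * w' t + 3 * w t / 4) r / r\<^sup>2
      + 2 * (emden_fowler (\<lambda>t. w' t - w t / 2) r / r) / r
    = - (a * emden_fowler w r ^ 5 + b * emden_fowler w r ^ 2 * emden_fowler z r ^ 3)"
proof -
  define e where "e = exp (- (ln r / 2))"
  define k where "k = 1 / r"
  have k: "x / r = x * k" "x / r\<^sup>2 = x * k\<^sup>2" for x by (simp_all add: k_def power2_eq_square)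
  have "e ^ 4 * r\<^sup>2 = 1" using exp_half_ln(1)[OF assms] by (simp add: e_def)
  then have "e ^ 4 = k ^ 2" using assms by (simp add: k_def field_simps)
  then have e5: "e * k ^ 2 = e ^ 5" by (simp add: eval_nat_numeral)
  have "e * (w (ln r) / 4 - a * w (ln r) ^ 5 - b * w (ln r) ^ 2 * z (ln r) ^ 3 - 2 * w' (ln r) + 3 * w (ln r) / 4) * k\<^sup>2
      + 2 * (e * (w' (ln r) - w (ln r) / 2) * k) * k
    = - ((e * k\<^sup>2) * (a * w (ln r) ^ 5 + b * w (ln r) ^ 2 * z (ln r) ^ 3))"
    by (simp add: algebra_simps power2_eq_square)
  also have "\<dots> = - (a * (e * w (ln r)) ^ 5 + b * (e * w (ln r)) ^ 2 * (e * z (ln r)) ^ 3)"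
    unfolding e5 by (simp add: algebra_simps eval_nat_numeral)
  finally show ?thesis unfolding emden_fowler_def e_def[symmetric] k .
qed

section \<open>The conserved Hamiltonian\<close>

lemma hamiltonian_constant:
  fixes w z w' z' :: "real \<Rightarrow> real" and \<mu>\<^sub>1 \<mu>\<^sub>2 \<beta> :: real
  defines "E \<equiv> \<lambda>t. (w' t ^ 2 + z' t ^ 2) / 2 - (w t ^ 2 + z t ^ 2) / 8
      + (\<mu>\<^sub>1 * z t ^ 6 + \<mu>\<^sub>2 * w t ^ 6 + 2 * \<beta> * z t ^ 3 * w t ^ 3) / 6"
  assumes w: "\<And>t. t < T \<Longrightarrow> (w has_real_derivative w' t) (at t)"
    "\<And>t. t < T \<Longrightarrow> (w' has_real_derivative w t / 4 - \<mu>\<^sub>2 * w t ^ 5 - \<beta> * w t ^ 2 * z t ^ 3) (at t)"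
    and z: "\<And>t. t < T \<Longrightarrow> (z has_real_derivative z' t) (at t)"
    "\<And>t. t < T \<Longrightarrow> (z' has_real_derivative z t / 4 - \<mu>\<^sub>1 * z t ^ 5 - \<beta> * z t ^ 2 * w t ^ 3) (at t)"
    and lim: "(w \<longlongrightarrow> l) at_bot" "(w' \<longlongrightarrow> 0) at_bot" "(z \<longlongrightarrow> 0) at_bot" "(z' \<longlongrightarrow> 0) at_bot"
    and t: "t < T"
  shows "E t = \<mu>\<^sub>2 * l ^ 6 / 6 - l ^ 2 / 8"
proof -
  have "(E has_real_derivative 0) (at t within {..<T})" if "t \<in> {..<T}" for t
  proof -
    have t: "t < T" using that by simp
    show ?thesis unfolding E_def
      by (rule has_field_derivative_at_within)
        (rule derivative_eq_intros w[OF t] z[OF t] refl | simp add: field_simps power_numeral_reduce)+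
  qed
  then obtain c where c: "\<And>t. t < T \<Longrightarrow> E t = c"
    using has_field_derivative_zero_constant[of "{..<T}" E] by auto
  have "(E \<longlongrightarrow> (0\<^sup>2 + 0\<^sup>2) / 2 - (l\<^sup>2 + 0\<^sup>2) / 8 + (\<mu>\<^sub>1 * 0 ^ 6 + \<mu>\<^sub>2 * l ^ 6 + 2 * \<beta> * 0 ^ 3 * l ^ 3) / 6) at_bot"
    unfolding E_def by (intro tendsto_intros lim) auto
  then have lim_E: "(E \<longlongrightarrow> \<mu>\<^sub>2 * l ^ 6 / 6 - l\<^sup>2 / 8) at_bot" by simp
  have "(E \<longlongrightarrow> c) at_bot"
    by (rule tendsto_eventually) (rule eventually_mono[OF eventually_gt_at_bot[of T]], rule c)
  from tendsto_unique[OF _ this lim_E] show ?thesis using c[OF t] by simp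
qed

section \<open>Semi-singular solutions\<close>

lemma semi_singular_solution:
  fixes \<mu>\<^sub>1 \<mu>\<^sub>2 \<beta> :: real
  assumes \<mu>\<^sub>2: "\<mu>\<^sub>2 > 0"
  obtains u v A where "positive_solution \<mu>\<^sub>1 \<mu>\<^sub>2 \<beta> u v"
    "radially_symmetric u" "radially_symmetric v" "Bfun u (at 0)" "\<not> Bfun v (at 0)"
    "A > 0" "(u \<longlongrightarrow> A) (at 0)"
    "((\<lambda>x. norm x powr (1/2) * v x) \<longlongrightarrow> (4 * \<mu>\<^sub>2) powr (- (1/4))) (at 0)"
    "has_pohozaev_invariant \<mu>\<^sub>1 \<mu>\<^sub>2 \<beta> u v (- (pi / (6 * sqrt \<mu>\<^sub>2)))"
proof (rule emden_fowler_orbit[OF \<mu>\<^sub>2, where \<mu>\<^sub>1 = \<mu>\<^sub>1 and \<beta> = \<beta>])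
  fix w w' z z' :: "real \<Rightarrow> real" and A
  assume pos: "\<And>t. t < 1 \<Longrightarrow> 0 < w t" "\<And>t. t < 1 \<Longrightarrow> 0 < z t"
    and w: "\<And>t. t < 1 \<Longrightarrow> (w has_real_derivative w' t) (at t)"
    "\<And>t. t < 1 \<Longrightarrow> (w' has_real_derivative w t / 4 - \<mu>\<^sub>2 * w t ^ 5 - \<beta> * w t ^ 2 * z t ^ 3) (at t)"
    and z: "\<And>t. t < 1 \<Longrightarrow> (z has_real_derivative z' t) (at t)"
    "\<And>t. t < 1 \<Longrightarrow> (z' has_real_derivative z t / 4 - \<mu>\<^sub>1 * z t ^ 5 - \<beta> * z t ^ 2 * w t ^ 3) (at t)"
    and lim: "(w \<longlongrightarrow> (4 * \<mu>\<^sub>2) powr (- (1/4))) at_bot" "(w' \<longlongrightarrow> 0) at_bot"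
      "(z \<longlongrightarrow> 0) at_bot" "(z' \<longlongrightarrow> 0) at_bot"
    and A: "0 < A" "((\<lambda>t. exp (- (t / 2)) * z t) \<longlongrightarrow> A) at_bot"
  define F' where "F' r = emden_fowler (\<lambda>t. w' t - w t / 2) r / r" for r
  define F'' where "F'' r = emden_fowler (\<lambda>t. w t / 4 - \<mu>\<^sub>2 * w t ^ 5 - \<beta> * w t ^ 2 * z t ^ 3
      - 2 * w' t + 3 * w t / 4) r / r\<^sup>2" for r
  define H' where "H' r = emden_fowler (\<lambda>t. z' t - z t / 2) r / r" for r
  define H'' where "H'' r = emden_fowler (\<lambda>t. z t / 4 - \<mu>\<^sub>1 * z t ^ 5 - \<beta> * z t ^ 2 * w t ^ 3
      - 2 * z' t + 3 * z t / 4) r / r\<^sup>2" for r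
  define u v :: "real^3 \<Rightarrow> real"
    where "u x = emden_fowler z (norm x)" and "v x = emden_fowler w (norm x)" for x
  have ln: "ln r < 1" if "0 < r" "r < 2" for r :: real
  proof -
    have "ln r < ln 2" using that by simp
    then show ?thesis using ln_2_less_1 by linarith
  qed
  have F: "(emden_fowler w has_real_derivative F' r) (at r)" "(F' has_real_derivative F'' r) (at r)"
    and H: "(emden_fowler z has_real_derivative H' r) (at r)" "(H' has_real_derivative H'' r) (at r)"
    if r: "0 < r" "r < 2" for r
    unfolding F'_def[abs_def] F''_def H'_def[abs_def] H''_def
    by (rule emden_fowler_derivatives(1)[where w = w and w' = w', OF r(1) w(1)[OF ln[OF r]]]
        emden_fowler_derivatives(2)[where w = w and w' = w', OF r(1) w(1)[OF ln[OF r]]] w(2)[OF ln[OF r]]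
        emden_fowler_derivatives(1)[where w = z and w' = z', OF r(1) z(1)[OF ln[OF r]]]
        emden_fowler_derivatives(2)[where w = z and w' = z', OF r(1) z(1)[OF ln[OF r]]] z(2)[OF ln[OF r]])+
  have isC: "isCont w t" "isCont w' t" "isCont z t" "isCont z' t" if "t < 1" for t
    using w[OF that] z[OF that] DERIV_isCont by blast+
  have comp: "continuous_on {0<..<2} (\<lambda>r. f (ln r))" if "\<And>t. t < 1 \<Longrightarrow> isCont f t" for f :: "real \<Rightarrow> real"
    by (rule continuous_on_compose2[of "{..<1}" f])
      (use that ln in \<open>auto intro!: continuous_intros continuous_at_imp_continuous_on\<close>)
  have cont: "continuous_on {0<..<2} F''" "continuous_on {0<..<2} H''"
    unfolding F''_def[abs_def] H''_def[abs_def] emden_fowler_def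
    by (auto intro!: continuous_intros comp isC)
  have pb: "punctured_ball = ball 0 2 - {0}" by (rule punctured_ball_def)
  have sol: "positive_solution \<mu>\<^sub>1 \<mu>\<^sub>2 \<beta> u v"
    unfolding positive_solution_def
  proof (intro conjI ballI)
    show "C2_on punctured_ball u" "C2_on punctured_ball v"
      unfolding pb u_def[abs_def] v_def[abs_def]
      by (rule radial_C2_on[OF H cont(2)] radial_C2_on[OF F cont(1)]; assumption)+
    fix x assume x: "x \<in> punctured_ball"
    then have r: "0 < norm x" "norm x < 2" by (auto simp: pb)
    show "0 < u x" "0 < v x"
      unfolding u_def v_def emden_fowler_def using pos ln[OF r] by auto
    have "laplacian u x = H'' (norm x) + 2 * H' (norm x) / norm x"
      unfolding u_def[abs_def] by (rule radial_laplacian[where R = 2]) (use r in \<open>simp_all add: H\<close>)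
    then show "- laplacian u x = \<mu>\<^sub>1 * u x ^ 5 + \<beta> * u x ^ 2 * v x ^ 3"
      by (simp only: u_def v_def H'_def H''_def emden_fowler_equation[OF r(1)] minus_minus)
    have "laplacian v x = F'' (norm x) + 2 * F' (norm x) / norm x"
      unfolding v_def[abs_def] by (rule radial_laplacian[where R = 2]) (use r in \<open>simp_all add: F\<close>)
    then show "- laplacian v x = \<mu>\<^sub>2 * v x ^ 5 + \<beta> * v x ^ 2 * u x ^ 3"
      by (simp only: u_def v_def F'_def F''_def emden_fowler_equation[OF r(1)] minus_minus)
  qed
  have norm_at_right: "filterlim (norm :: real^3 \<Rightarrow> real) (at_right 0) (at 0)"
    by (rule tendsto_imp_filterlim_at_right)
      (auto intro!: tendsto_eq_intros simp: eventually_at_filter)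
  have ln_norm: "filterlim (\<lambda>x :: real^3. ln (norm x)) at_bot (at 0)"
    by (rule filterlim_compose[OF ln_at_0 norm_at_right])
  have limu: "(u \<longlongrightarrow> A) (at 0)"
    using filterlim_compose[OF A(2) ln_norm] by (simp add: u_def[abs_def] emden_fowler_def)
  have "((\<lambda>x :: real^3. w (ln (norm x))) \<longlongrightarrow> (4 * \<mu>\<^sub>2) powr (- (1/4))) (at 0)"
    by (rule filterlim_compose[OF lim(1) ln_norm])
  moreover have "\<forall>\<^sub>F x :: real^3 in at 0. w (ln (norm x)) = norm x powr (1/2) * v x"
    unfolding eventually_at_filter
    by (rule always_eventually)
      (auto simp: v_def emden_fowler_def powr_def mult.assoc[symmetric] simp flip: exp_add)
  ultimately have limv: "((\<lambda>x. norm x powr (1/2) * v x) \<longlongrightarrow> (4 * \<mu>\<^sub>2) powr (- (1/4))) (at 0)"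
    by (rule Lim_transform_eventually)
  have Bu: "Bfun u (at 0)"
  proof (rule BfunI)
    show "\<forall>\<^sub>F x in at 0. norm (u x) \<le> \<bar>A\<bar> + 1"
      using tendstoD[OF limu, of 1] by (auto elim!: eventually_mono simp: dist_real_def)
  qed
  have nBv: "\<not> Bfun v (at 0)"
  proof
    assume "Bfun v (at 0)"
    then obtain K where K: "\<forall>\<^sub>F x in at 0. norm (v x) \<le> K" by (auto simp: Bfun_def)
    have n0: "((\<lambda>x :: real^3. norm x powr (1/2) * K) \<longlongrightarrow> 0) (at 0)"
      by (rule tendsto_eq_intros refl tendsto_norm_zero | simp)+
    have "((\<lambda>x. norm x powr (1/2) * v x) \<longlongrightarrow> 0) (at 0)"
      by (rule Lim_null_comparison[OF _ n0])
        (use K in \<open>auto elim!: eventually_mono simp: abs_mult intro!: mult_left_mono\<close>)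
    from tendsto_unique[OF _ limv this] \<mu>\<^sub>2 show False by simp
  qed
  have poh: "has_pohozaev_invariant \<mu>\<^sub>1 \<mu>\<^sub>2 \<beta> u v (- (pi / (6 * sqrt \<mu>\<^sub>2)))"
    unfolding has_pohozaev_invariant_def
  proof (intro allI impI)
    fix r :: real assume "0 < r \<and> r < 2"
    then have r: "0 < r" "r < 2" by auto
    define t where "t = ln r"
    have t: "t < 1" using ln[OF r] by (simp add: t_def)
    define l where "l = (4 * \<mu>\<^sub>2) powr (- (1/4))"
    have "l ^ 2 = l powr 2" using \<mu>\<^sub>2 powr_realpow[of l 2] by (simp add: l_def)
    also have "\<dots> = (4 * \<mu>\<^sub>2) powr (- (1/2))" by (simp add: l_def powr_powr)
    also have "\<dots> = 1 / (2 * sqrt \<mu>\<^sub>2)"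
      using \<mu>\<^sub>2 by (simp add: powr_minus_divide powr_half_sqrt real_sqrt_mult)
    finally have l2: "l ^ 2 = 1 / (2 * sqrt \<mu>\<^sub>2)" .
    have "\<mu>\<^sub>2 * l ^ 6 = \<mu>\<^sub>2 * (l ^ 2) ^ 3" by (simp flip: power_mult)
    also have "\<dots> = 1 / (8 * sqrt \<mu>\<^sub>2)"
      unfolding l2 using \<mu>\<^sub>2 by (simp add: power3_eq_cube field_simps)
    finally have l6: "\<mu>\<^sub>2 * l ^ 6 = 1 / (8 * sqrt \<mu>\<^sub>2)" .
    have "(w' t ^ 2 + z' t ^ 2) / 2 - (w t ^ 2 + z t ^ 2) / 8
      + (\<mu>\<^sub>1 * z t ^ 6 + \<mu>\<^sub>2 * w t ^ 6 + 2 * \<beta> * z t ^ 3 * w t ^ 3) / 6 = \<mu>\<^sub>2 * l ^ 6 / 6 - l\<^sup>2 / 8"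
      by (rule hamiltonian_constant[where T = 1]) (fact w z lim[folded l_def] t)+
    also have "\<dots> = - 1 / (24 * sqrt \<mu>\<^sub>2)"
      unfolding l6 l2 using \<mu>\<^sub>2 by (simp add: field_simps)
    finally have E: "(w' t ^ 2 + z' t ^ 2) / 2 - (w t ^ 2 + z t ^ 2) / 8
      + (\<mu>\<^sub>1 * z t ^ 6 + \<mu>\<^sub>2 * w t ^ 6 + 2 * \<beta> * z t ^ 3 * w t ^ 3) / 6 = - 1 / (24 * sqrt \<mu>\<^sub>2)" .
    \<comment> \<open>The integrand of the Pohozaev integral is constant on the sphere of radius $r$.\<close>
    define c where "c = 1/2 * (emden_fowler z r * H' r + emden_fowler w r * F' r)
     - r/2 * ((H' r)\<^sup>2 + (F' r)\<^sup>2) + r * (H' r)\<^sup>2 + r * (F' r)\<^sup>2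
     + r/6 * (\<mu>\<^sub>1 * emden_fowler z r ^ 6 + \<mu>\<^sub>2 * emden_fowler w r ^ 6
         + 2 * \<beta> * emden_fowler z r ^ 3 * emden_fowler w r ^ 3)"
    have poh: "pohozaev \<mu>\<^sub>1 \<mu>\<^sub>2 \<beta> r u v = 4 * pi * r\<^sup>2 * c"
      unfolding pohozaev_def
    proof (rule sphere_integral_const)
      fix x :: "real^3" assume n: "norm x = r"
      then have x: "x \<in> ball 0 2 - {0}" using r by auto
      have "normal_deriv u x = H' r" "norm (grad u x) = \<bar>H' r\<bar>"
        "normal_deriv v x = F' r" "norm (grad v x) = \<bar>F' r\<bar>"
        unfolding u_def[abs_def] v_def[abs_def] n[symmetric]
        by (rule radial_normal_deriv[where R = 2 and F = "emden_fowler z" and F' = H' and F'' = H'']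
            radial_normal_deriv[where R = 2 and F = "emden_fowler w" and F' = F' and F'' = F''];
            use x in \<open>simp add: F H\<close>)+
      then show "1/2 * (u x * normal_deriv u x + v x * normal_deriv v x)
     - r/2 * ((norm (grad u x))\<^sup>2 + (norm (grad v x))\<^sup>2)
     + r * \<bar>normal_deriv u x\<bar>\<^sup>2 + r * \<bar>normal_deriv v x\<bar>\<^sup>2
     + r/6 * (\<mu>\<^sub>1 * u x ^ 6 + \<mu>\<^sub>2 * v x ^ 6 + 2 * \<beta> * u x ^ 3 * v x ^ 3) = c"
        by (simp add: c_def u_def v_def n)
    qed (use r in simp)
    have rc: "r\<^sup>2 * c = - 1 / (24 * sqrt \<mu>\<^sub>2)"
    proof -
      \<comment> \<open>The powers of $r$ are collected in the factors $r k = 1$ and $r e^2 = 1$; what remains is the Hamiltonian.\<close>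
      define e where "e = exp (- (t / 2))"
      define k where "k = 1 / r"
      have k: "x / r = x * k" for x by (simp add: k_def)
      have kr: "r * k = 1" "r * e ^ 2 = 1"
        using r exp_half_ln(2)[OF r(1)] by (simp_all add: k_def e_def t_def mult.commute)
      have "r\<^sup>2 * c = (r * e ^ 2) * (r * k) * ((z t * (z' t - z t / 2) + w t * (w' t - w t / 2)) / 2)
          + (r * e ^ 2) * (r * k)\<^sup>2 * (((z' t - z t / 2)\<^sup>2 + (w' t - w t / 2)\<^sup>2) / 2)
          + (r * e ^ 2) ^ 3 * ((\<mu>\<^sub>1 * z t ^ 6 + \<mu>\<^sub>2 * w t ^ 6 + 2 * \<beta> * z t ^ 3 * w t ^ 3) / 6)"
        unfolding c_def F'_def H'_def emden_fowler_def t_def[symmetric] e_def[symmetric] k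
        by (simp add: field_simps eval_nat_numeral)
      also have "\<dots> = (w' t ^ 2 + z' t ^ 2) / 2 - (w t ^ 2 + z t ^ 2) / 8
          + (\<mu>\<^sub>1 * z t ^ 6 + \<mu>\<^sub>2 * w t ^ 6 + 2 * \<beta> * z t ^ 3 * w t ^ 3) / 6"
        unfolding kr by (simp add: field_simps power2_eq_square)
      finally show ?thesis unfolding E .
    qed
    show "pohozaev \<mu>\<^sub>1 \<mu>\<^sub>2 \<beta> r u v = - (pi / (6 * sqrt \<mu>\<^sub>2))"
      unfolding poh mult.assoc rc by simp
  qed
  show thesis
    by (rule that[OF sol _ _ Bu nBv A(1) limu limv poh]) (simp_all add: radially_symmetric_def u_def v_def)
qed

lemma positive_solution_swap:
  "positive_solution \<mu>\<^sub>2 \<mu>\<^sub>1 \<beta> v u \<Longrightarrow> positive_solution \<mu>\<^sub>1 \<mu>\<^sub>2 \<beta> u v"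
  unfolding positive_solution_def by blast

theorem theorem1p3:
  fixes \<mu>\<^sub>1 \<mu>\<^sub>2 \<beta> :: real
  assumes "\<mu>\<^sub>1 > 0" and "\<mu>\<^sub>2 > 0" and "\<beta> > 0"
  shows "(\<exists>u v A.
            positive_solution \<mu>\<^sub>1 \<mu>\<^sub>2 \<beta> u v \<and>
            radially_symmetric u \<and> radially_symmetric v \<and>
            semi_singular u v \<and>
            A > 0 \<and> (u \<longlongrightarrow> A) (at 0) \<and>
            ((\<lambda>x. norm x powr (1/2) * v x) \<longlongrightarrow> (4 * \<mu>\<^sub>2) powr (- (1/4))) (at 0) \<and>
            has_pohozaev_invariant \<mu>\<^sub>1 \<mu>\<^sub>2 \<beta> u v (- (pi / (6 * sqrt \<mu>\<^sub>2))) \<and>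
            - (pi / (6 * sqrt \<mu>\<^sub>2)) < 0) \<and>
         (\<exists>u v B.
            positive_solution \<mu>\<^sub>1 \<mu>\<^sub>2 \<beta> u v \<and>
            radially_symmetric u \<and> radially_symmetric v \<and>
            semi_singular u v \<and>
            B > 0 \<and> (v \<longlongrightarrow> B) (at 0) \<and>
            ((\<lambda>x. norm x powr (1/2) * u x) \<longlongrightarrow> (4 * \<mu>\<^sub>1) powr (- (1/4))) (at 0))"
proof
  obtain u v A where "positive_solution \<mu>\<^sub>1 \<mu>\<^sub>2 \<beta> u v"
    "radially_symmetric u" "radially_symmetric v" "Bfun u (at 0)" "\<not> Bfun v (at 0)"
    "A > 0" "(u \<longlongrightarrow> A) (at 0)"
    "((\<lambda>x. norm x powr (1/2) * v x) \<longlongrightarrow> (4 * \<mu>\<^sub>2) powr (- (1/4))) (at 0)"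
    "has_pohozaev_invariant \<mu>\<^sub>1 \<mu>\<^sub>2 \<beta> u v (- (pi / (6 * sqrt \<mu>\<^sub>2)))"
    by (rule semi_singular_solution[OF assms(2)])
  moreover from this have "semi_singular u v" by (simp add: semi_singular_def)
  moreover have "- (pi / (6 * sqrt \<mu>\<^sub>2)) < 0" using assms(2) by simp
  ultimately show "\<exists>u v A.
            positive_solution \<mu>\<^sub>1 \<mu>\<^sub>2 \<beta> u v \<and>
            radially_symmetric u \<and> radially_symmetric v \<and>
            semi_singular u v \<and>
            A > 0 \<and> (u \<longlongrightarrow> A) (at 0) \<and>
            ((\<lambda>x. norm x powr (1/2) * v x) \<longlongrightarrow> (4 * \<mu>\<^sub>2) powr (- (1/4))) (at 0) \<and>
            has_pohozaev_invariant \<mu>\<^sub>1 \<mu>\<^sub>2 \<beta> u v (- (pi / (6 * sqrt \<mu>\<^sub>2))) \<and>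
            - (pi / (6 * sqrt \<mu>\<^sub>2)) < 0"
    by (intro exI conjI)
  obtain u v B where "positive_solution \<mu>\<^sub>2 \<mu>\<^sub>1 \<beta> v u"
    "radially_symmetric v" "radially_symmetric u" "Bfun v (at 0)" "\<not> Bfun u (at 0)"
    "B > 0" "(v \<longlongrightarrow> B) (at 0)"
    "((\<lambda>x. norm x powr (1/2) * u x) \<longlongrightarrow> (4 * \<mu>\<^sub>1) powr (- (1/4))) (at 0)"
    by (rule semi_singular_solution[OF assms(1)])
  moreover from this have "semi_singular u v" by (simp add: semi_singular_def)
  moreover from calculation(1) have "positive_solution \<mu>\<^sub>1 \<mu>\<^sub>2 \<beta> u v"
    by (rule positive_solution_swap)
  ultimately show "\<exists>u v B.
            positive_solution \<mu>\<^sub>1 \<mu>\<^sub>2 \<beta> u v \<and>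
            radially_symmetric u \<and> radially_symmetric v \<and>
            semi_singular u v \<and>
            B > 0 \<and> (v \<longlongrightarrow> B) (at 0) \<and>
            ((\<lambda>x. norm x powr (1/2) * u x) \<longlongrightarrow> (4 * \<mu>\<^sub>1) powr (- (1/4))) (at 0)"
    by (intro exI conjI)
qed

end
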